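(* Let $\hat{A} \in \mathbb{D}\mathbb{C}^{m \times q}$ and $\hat{B} \in \mathbb{D}\mathbb{C}^{q \times n}$ be dual complex matrices. If $$\hat{A}^N\hat{A}\hat{B}\hat{B}^*\hat{A}^*=\hat{B}\hat{B}^*\hat{A}^*_{e} \quad\text{and}\quad \hat{B}\hat{B}^N\hat{A}^*\hat{A}\hat{B}=\hat{A}^*\hat{A}\hat{B}_{e},$$ then $(\hat{A}\hat{B})^N=\hat{B}^N\hat{A}^N$.
   Context: A dual complex number is $\hat a=a_s+a_d\epsilon$ with $a_s,a_d\in\mathbb{C}$, where $\epsilon$ commutes with complex numbers and $\epsilon^2=0$; it is a dual number if $a_s,a_d\in\mathbb{R}$. A dual number is positive appreciable if $a_s>0$, and positive infinitesimal if $a_s=0$ and $a_d>0$. $\mathbb{D}\mathbb{C}^{m\times n}$ is the set of $m\times n$ dual complex matrices $\hat A=A_s+A_d\epsilon$, $A_s,A_d\in\mathbb{C}^{m\times n}$, and $\hat A^*=A_s^*+A_d^*\epsilon$ (conjugate transpose). $\hat U$ (square) is unitary if $\hat U^*\hat U=\hat U\hat U^*=I$. Known fact (SVD): every $\hat A\in\mathbb{D}\mathbb{C}^{m\times n}$ can be written $\hat A=\hat U\begin{bmatrix}\hat\Sigma_1&O\\O&\hat\Sigma_2\end{bmatrix}\hat V^*$ with $\hat U\in\mathbb{D}\mathbb{C}^{m\times m}$, $\hat V\in\mathbb{D}\mathbb{C}^{n\times n}$ unitary, $\hat\Sigma_1=\mathrm{diag}(\hat\mu_1,\dots,\hat\mu_r)$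 with positive appreciable dual numbers on the diagonal, and $\hat\Sigma_2$ a (rectangular) diagonal matrix with diagonal entries that are positive infinitesimal dual numbers or zero. The essential part of $\hat A$ is $\hat A_e=\hat U\begin{bmatrix}\hat\Sigma_1&O\\O&O\end{bmatrix}\hat V^*$; $\hat A_e^*$ denotes $(\hat A_e)^*$. The new dual Moore-Penrose inverse (NDMPI) $\hat A^N\in\mathbb{D}\mathbb{C}^{n\times m}$ of $\hat A$ is the unique $\hat X$ (known to exist for every $\hat A$) satisfying $\hat A\hat X\hat A=\hat A_e$, $\hat X\hat A\hat X=\hat X$, $(\hat A\hat X)^*=\hat A\hat X$, $(\hat X\hat A)^*=\hat X\hat A$; in terms of the SVD, $\hat A^N=\hat V\begin{bmatrix}\hat\Sigma_1^{-1}&O\\O&O\end{bmatrix}\hat U^*$. *)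

theory Defs
  imports Jordan_Normal_Form.Matrix Jordan_Normal_Form.Conjugate
begin

datatype dual_complex = Dual (std_part: complex) (inf_part: complex)

instantiation dual_complex :: comm_ring_1
begin

definition "0 = Dual 0 0"
definition "1 = Dual 1 0"
definition "a + b = Dual (std_part a + std_part b) (inf_part a + inf_part b)"
definition "a - b = Dual (std_part a - std_part b) (inf_part a - inf_part b)"
definition "- a = Dual (- std_part a) (- inf_part a)"
definition "a * b = Dual (std_part a * std_part b)
                         (std_part a * inf_part b + inf_part a * std_part b)"

instance
  by standard
    (auto simp: zero_dual_complex_def one_dual_complex_def plus_dual_complex_def
       minus_dual_complex_def uminus_dual_complex_def times_dual_complex_def algebra_simps)

end

lemma dual_complex_eps:
  "Dual a b = Dual a 0 + Dual b 0 * Dual 0 1"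
  "Dual 0 1 * Dual 0 1 = 0"
  by (simp_all add: zero_dual_complex_def plus_dual_complex_def times_dual_complex_def)

instantiation dual_complex :: conjugatable_ring
begin

definition "conjugate a = Dual (cnj (std_part a)) (cnj (inf_part a))"

instance
proof
  fix a b :: dual_complex
  show "conjugate (conjugate a) = a"
    by (simp add: conjugate_dual_complex_def)
  show "conjugate a = conjugate b \<longleftrightarrow> a = b"
    by (cases a; cases b) (simp add: conjugate_dual_complex_def)
qed (auto simp: conjugate_dual_complex_def zero_dual_complex_def plus_dual_complex_def
       uminus_dual_complex_def times_dual_complex_def)

end

definition dual_number :: "dual_complex \<Rightarrow> bool" where
  "dual_number a \<longleftrightarrow> std_part a \<in> \<real> \<and> inf_part a \<in> \<real>"

definition positive_appreciable :: "dual_complex \<Rightarrow> bool" where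
  "positive_appreciable a \<longleftrightarrow> dual_number a \<and> Re (std_part a) > 0"

definition positive_infinitesimal :: "dual_complex \<Rightarrow> bool" where
  "positive_infinitesimal a \<longleftrightarrow> dual_number a \<and> std_part a = 0 \<and> Re (inf_part a) > 0"

(* Schur_Decomposition.mat_adjoint needs entries in a field, which dual_complex is not. *)
definition conj_transpose :: "dual_complex mat \<Rightarrow> dual_complex mat" where
  "conj_transpose A = transpose_mat (map_mat conjugate A)"

definition unitary_dual :: "dual_complex mat \<Rightarrow> bool" where
  "unitary_dual U \<longleftrightarrow> square_mat U \<and>
     conj_transpose U * U = 1\<^sub>m (dim_row U) \<and> U * conj_transpose U = 1\<^sub>m (dim_row U)"

(* diagonal_mat also applies to rectangular matrices such as S2. *)
definition is_dual_svd ::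
  "dual_complex mat \<Rightarrow> nat \<Rightarrow> dual_complex mat \<Rightarrow> dual_complex mat \<Rightarrow> dual_complex mat
     \<Rightarrow> dual_complex mat \<Rightarrow> bool" where
  "is_dual_svd A r U S1 S2 V \<longleftrightarrow>
     (let m = dim_row A; n = dim_col A in
       r \<le> m \<and> r \<le> n \<and>
       U \<in> carrier_mat m m \<and> unitary_dual U \<and>
       V \<in> carrier_mat n n \<and> unitary_dual V \<and>
       S1 \<in> carrier_mat r r \<and> diagonal_mat S1 \<and>
       (\<forall>i<r. positive_appreciable (S1 $$ (i, i))) \<and>
       S2 \<in> carrier_mat (m - r) (n - r) \<and> diagonal_mat S2 \<and>
       (\<forall>i<min (m - r) (n - r). positive_infinitesimal (S2 $$ (i, i)) \<or> S2 $$ (i, i) = 0) \<and>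
       A = U * four_block_mat S1 (0\<^sub>m r (n - r)) (0\<^sub>m (m - r) r) S2 * conj_transpose V)"

(* Every dual complex matrix has an SVD, and the matrix below does not depend on its choice. *)
definition essential_part :: "dual_complex mat \<Rightarrow> dual_complex mat" where
  "essential_part A =
     (THE E. \<exists>r U S1 S2 V. is_dual_svd A r U S1 S2 V \<and>
        E = U * four_block_mat S1 (0\<^sub>m r (dim_col A - r))
                  (0\<^sub>m (dim_row A - r) r) (0\<^sub>m (dim_row A - r) (dim_col A - r))
              * conj_transpose V)"

definition is_ndmpi :: "dual_complex mat \<Rightarrow> dual_complex mat \<Rightarrow> bool" where
  "is_ndmpi A X \<longleftrightarrow>
     X \<in> carrier_mat (dim_col A) (dim_row A) \<and>
     A * X * A = essential_part A \<and>
     X * A * X = X \<and>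
     conj_transpose (A * X) = A * X \<and>
     conj_transpose (X * A) = X * A"

definition ndmpi :: "dual_complex mat \<Rightarrow> dual_complex mat" where
  "ndmpi A = (THE X. is_ndmpi A X)"

end

(* The essential part C of A and the NDMPI X of A are characterised without reference to an SVD:
   X is the Moore-Penrose inverse of C, and D = A - C is infinitesimal with X D = 0 and D X = 0.
   Put P = X A, the projector onto the row space of C, and let Q = B B^N be the projector onto the
   column space of B_e. Since D^* D = 0, A^* A = C^* C, and likewise B B^* = B_e B_e^*. The two
   hypotheses say that P commutes with B B^* and Q with A^* A; hence P and Q commute with each
   other and with the Moore-Penrose inverses of these Gram matrices, and A_e B_e and B^N A^N satisfy
   the characterisation for A B.

   Since the essential part is defined through an SVD, the existence of SVDs is needed. Singular
   pairs come from eigenvectors of A^* A obtained by first-order perturbation theory, and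
   are split off one at a time by Householder reflections over the dual numbers. *)
theory Submission
  imports Defs Jordan_Normal_Form.Spectral_Radius
begin

text \<open>The dual numbers have zero divisors: \<open>Dual 0 1\<close>, as a 1 by 1 matrix, has no
  Moore-Penrose inverse. Hence the inverse is attached to the essential part \<open>C\<close>, and
  the rest \<open>D\<close> has to be controlled separately. What makes the splitting unique is that
  a factor next to an infinitesimal matrix counts only through its standard part, and there two
  competing splittings already agree. The relation eps^2 = 0 also makes first-order expansions
  exact: inverses, square roots and perturbed eigenvectors all stop after the linear term. The Gram
  matrix of \<open>A\<close> forgets \<open>D\<close>, so the infinitesimal singular values cannot
  be read off it. They are reached once the remaining block is wholly infinitesimal: it is then eps
  times a complex matrix, and the singular pairs of that matrix serve.\<close>

section \<open>Matrix arithmetic\<close>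

lemma mat_assoc:
  fixes A :: "'a :: semiring_0 mat"
  shows "dim_col A = dim_row B \<Longrightarrow> dim_col B = dim_row C \<Longrightarrow> A * B * C = A * (B * C)"
  by (rule assoc_mult_mat[of _ "dim_row A" "dim_row B" _ "dim_row C" _ "dim_col C"]) auto

lemma mat_add_mult:
  fixes A :: "'a :: semiring_0 mat"
  shows "dim_row A = dim_row B \<Longrightarrow> dim_col A = dim_col B \<Longrightarrow> dim_col B = dim_row C
    \<Longrightarrow> (A + B) * C = A * C + B * C"
  by (rule add_mult_distrib_mat[of _ "dim_row A" "dim_col A" _ _ "dim_col C"]) auto

lemma mat_mult_add:
  fixes A :: "'a :: semiring_0 mat"
  shows "dim_row A = dim_row B \<Longrightarrow> dim_col A = dim_col B \<Longrightarrow> dim_col C = dim_row A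
    \<Longrightarrow> C * (A + B) = C * A + C * B"
  by (rule mult_add_distrib_mat[of _ "dim_row C" "dim_col C" _ "dim_col A" _]) auto

lemma mat_minus_mult:
  fixes A :: "'a :: ring mat"
  shows "dim_row A = dim_row B \<Longrightarrow> dim_col A = dim_col B \<Longrightarrow> dim_col B = dim_row C
    \<Longrightarrow> (A - B) * C = A * C - B * C"
  by (rule minus_mult_distrib_mat[of _ "dim_row A" "dim_col A" _ _ "dim_col C"]) auto

lemma mat_mult_minus:
  fixes A :: "'a :: ring mat"
  shows "dim_row A = dim_row B \<Longrightarrow> dim_col A = dim_col B \<Longrightarrow> dim_col C = dim_row A
    \<Longrightarrow> C * (A - B) = C * A - C * B"
  by (rule mult_minus_distrib_mat[of _ "dim_row C" "dim_col C" _ "dim_col A" _]) auto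

lemma mat_mult_smult:
  fixes A :: "'a :: comm_semiring_0 mat"
  shows "dim_col A = dim_row B \<Longrightarrow> A * (c \<cdot>\<^sub>m B) = c \<cdot>\<^sub>m (A * B)"
  by (rule mult_smult_distrib[of _ "dim_row A" "dim_col A" _ "dim_col B"]) auto

lemma mat_smult_mult:
  fixes A :: "'a :: comm_semiring_0 mat"
  shows "dim_col A = dim_row B \<Longrightarrow> (c \<cdot>\<^sub>m A) * B = c \<cdot>\<^sub>m (A * B)"
  by (rule mult_smult_assoc_mat[of _ "dim_row A" "dim_col A" _ "dim_col B"]) auto

lemma mat_smult_smult: "c \<cdot>\<^sub>m (d \<cdot>\<^sub>m A) = (c * d) \<cdot>\<^sub>m (A :: 'a :: semigroup_mult mat)"
  by (rule eq_matI) (auto simp: mult.assoc)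

lemma mat_mult_zero:
  fixes A :: "'a :: semiring_0 mat"
  shows "dim_col A = n \<Longrightarrow> A * 0\<^sub>m n k = 0\<^sub>m (dim_row A) k"
    "dim_row A = n \<Longrightarrow> 0\<^sub>m k n * A = 0\<^sub>m k (dim_col A)"
  by (auto intro: right_mult_zero_mat[of _ "dim_row A"] left_mult_zero_mat[of _ _ "dim_col A"])

lemma mat_add_zero:
  fixes A :: "'a :: monoid_add mat"
  shows "dim_row A = n \<Longrightarrow> dim_col A = k \<Longrightarrow> A + 0\<^sub>m n k = A"
    "dim_row A = n \<Longrightarrow> dim_col A = k \<Longrightarrow> 0\<^sub>m n k + A = A"
  by auto

lemma mat_minus_zero:
  fixes A :: "'a :: group_add mat"
  shows "dim_row A = n \<Longrightarrow> dim_col A = k \<Longrightarrow> A - 0\<^sub>m n k = A"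
    "A - A = 0\<^sub>m (dim_row A) (dim_col A)"
  by auto

lemmas mat_simps = mat_minus_zero mat_add_zero mat_assoc mat_add_mult mat_mult_add mat_minus_mult mat_mult_minus
  mat_mult_smult mat_smult_mult mat_smult_smult mat_mult_zero

text \<open>Associativity nests products to the right, where an equation for \<open>A * B\<close> no
  longer matches; this form rewrites the pair in front of a further factor.\<close>

lemma mat_mult_eq_left:
  fixes A :: "'a :: semiring_0 mat"
  shows "A * B = C \<Longrightarrow> dim_col A = dim_row B \<Longrightarrow> dim_col B = dim_row Z \<Longrightarrow> A * (B * Z) = C * Z"
  by (simp add: mat_assoc[symmetric])

section \<open>The conjugate transpose\<close>

abbreviation adj :: "dual_complex mat \<Rightarrow> dual_complex mat" (\<open>_\<^sup>H\<close> [1000] 1000)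
  where "A\<^sup>H \<equiv> conj_transpose A"

lemma conjugate_dual_one [simp]: "conjugate (1 :: dual_complex) = 1"
  by (simp add: conjugate_dual_complex_def one_dual_complex_def)

lemma conjugate_dual_minus: "conjugate (a - b :: dual_complex) = conjugate a - conjugate b"
  by (simp add: conjugate_dual_complex_def minus_dual_complex_def)

lemma dim_adj [simp]: "dim_row A\<^sup>H = dim_col A" "dim_col A\<^sup>H = dim_row A"
  by (auto simp: conj_transpose_def)

lemma index_adj [simp]: "i < dim_col A \<Longrightarrow> j < dim_row A \<Longrightarrow> A\<^sup>H $$ (i, j) = conjugate (A $$ (j, i))"
  by (auto simp: conj_transpose_def)

lemma adj_adj [simp]: "A\<^sup>H\<^sup>H = A"
  by (rule eq_matI) auto

lemma adj_mult: "dim_col A = dim_row B \<Longrightarrow> (A * B)\<^sup>H = B\<^sup>H * A\<^sup>H"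
  by (rule eq_matI) (auto simp: scalar_prod_def sum_conjugate conjugate_dist_mul mult.commute
      intro!: sum.cong)

lemma adj_add: "dim_row A = dim_row B \<Longrightarrow> dim_col A = dim_col B \<Longrightarrow> (A + B)\<^sup>H = A\<^sup>H + B\<^sup>H"
  by (rule eq_matI) (auto simp: conjugate_dist_add)

lemma adj_minus: "dim_row A = dim_row B \<Longrightarrow> dim_col A = dim_col B \<Longrightarrow> (A - B)\<^sup>H = A\<^sup>H - B\<^sup>H"
  by (rule eq_matI) (auto simp: conjugate_dual_minus)

lemma adj_smult: "(c \<cdot>\<^sub>m A)\<^sup>H = conjugate c \<cdot>\<^sub>m A\<^sup>H"
  by (rule eq_matI) (auto simp: conjugate_dist_mul)

lemma adj_one [simp]: "(1\<^sub>m n)\<^sup>H = 1\<^sub>m n"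
  by (rule eq_matI) auto

lemma adj_zero [simp]: "(0\<^sub>m n k)\<^sup>H = 0\<^sub>m k n"
  by (rule eq_matI) auto

lemmas adj_simps = adj_mult adj_add adj_minus adj_smult

section \<open>Standard parts and infinitesimal matrices\<close>

text \<open>Both parts stay dual matrices, so they multiply with other dual matrices without a
  change of type; \<open>std_mat M = M\<close> then expresses that all entries of \<open>M\<close>
  are complex.\<close>

definition std_mat :: "dual_complex mat \<Rightarrow> dual_complex mat" where
  "std_mat A = map_mat (\<lambda>a. Dual (std_part a) 0) A"

definition inf_mat :: "dual_complex mat \<Rightarrow> dual_complex mat" where
  "inf_mat A = map_mat (\<lambda>a. Dual (inf_part a) 0) A"

lemma dual_parts [simp]:
  "std_part (a + b) = std_part a + std_part b" "inf_part (a + b) = inf_part a + inf_part b"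
  "std_part (a - b) = std_part a - std_part b" "inf_part (a - b) = inf_part a - inf_part b"
  "std_part (- a) = - std_part a" "inf_part (- a) = - inf_part a"
  "std_part (a * b) = std_part a * std_part b"
  "inf_part (a * b) = std_part a * inf_part b + inf_part a * std_part b"
  "std_part 0 = 0" "inf_part 0 = 0" "std_part 1 = 1" "inf_part 1 = 0"
  "std_part (conjugate a) = cnj (std_part a)" "inf_part (conjugate a) = cnj (inf_part a)"
  by (auto simp: zero_dual_complex_def one_dual_complex_def plus_dual_complex_def
      minus_dual_complex_def uminus_dual_complex_def times_dual_complex_def
      conjugate_dual_complex_def)

lemma dual_eq_iff: "a = b \<longleftrightarrow> std_part a = std_part b \<and> inf_part a = inf_part b"
  by (cases a; cases b) auto

lemma dual_part_sum [simp]: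
  "std_part (sum f S) = (\<Sum>x\<in>S. std_part (f x))" "inf_part (sum f S) = (\<Sum>x\<in>S. inf_part (f x))"
  by (induction S rule: infinite_finite_induct) auto

lemma dim_std_mat [simp]: "dim_row (std_mat A) = dim_row A" "dim_col (std_mat A) = dim_col A"
  "dim_row (inf_mat A) = dim_row A" "dim_col (inf_mat A) = dim_col A"
  by (auto simp: std_mat_def inf_mat_def)

lemma index_std_mat [simp]: "i < dim_row A \<Longrightarrow> j < dim_col A \<Longrightarrow>
    std_mat A $$ (i, j) = Dual (std_part (A $$ (i, j))) 0"
  "i < dim_row A \<Longrightarrow> j < dim_col A \<Longrightarrow> inf_mat A $$ (i, j) = Dual (inf_part (A $$ (i, j))) 0"
  by (auto simp: std_mat_def inf_mat_def)

lemma std_mat_std [simp]: "std_mat (std_mat A) = std_mat A" "std_mat (inf_mat A) = inf_mat A"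
  by (rule eq_matI; auto)+

lemma std_mat_mult: "dim_col A = dim_row B \<Longrightarrow> std_mat (A * B) = std_mat A * std_mat B"
  by (rule eq_matI) (auto simp: scalar_prod_def dual_eq_iff)

lemma std_mat_add: "dim_row A = dim_row B \<Longrightarrow> dim_col A = dim_col B \<Longrightarrow>
    std_mat (A + B) = std_mat A + std_mat B"
  by (rule eq_matI) (auto simp: dual_eq_iff)

lemma std_mat_minus: "dim_row A = dim_row B \<Longrightarrow> dim_col A = dim_col B \<Longrightarrow>
    std_mat (A - B) = std_mat A - std_mat B"
  by (rule eq_matI) (auto simp: dual_eq_iff)

lemma std_mat_smult: "std_mat (c \<cdot>\<^sub>m A) = Dual (std_part c) 0 \<cdot>\<^sub>m std_mat A"
  by (rule eq_matI) (auto simp: dual_eq_iff)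

lemma std_mat_adj: "std_mat (A\<^sup>H) = (std_mat A)\<^sup>H" "inf_mat (A\<^sup>H) = (inf_mat A)\<^sup>H"
  by (rule eq_matI; auto simp: dual_eq_iff)+

lemma std_mat_one [simp]: "std_mat (1\<^sub>m n) = 1\<^sub>m n"
  by (rule eq_matI) (auto simp: dual_eq_iff)

lemma std_mat_zero [simp]: "std_mat (0\<^sub>m n k) = 0\<^sub>m n k"
  by (rule eq_matI) (auto simp: dual_eq_iff)

lemmas std_simps = std_mat_mult std_mat_add std_mat_minus std_mat_smult std_mat_adj

lemma std_inf_decomp: "A = std_mat A + Dual 0 1 \<cdot>\<^sub>m inf_mat A"
  by (rule eq_matI) (auto simp: dual_eq_iff)

definition infinitesimal :: "dual_complex mat \<Rightarrow> bool" where
  "infinitesimal A \<longleftrightarrow> (\<forall>i<dim_row A. \<forall>j<dim_col A. std_part (A $$ (i, j)) = 0)"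

lemma infinitesimal_iff: "infinitesimal A \<longleftrightarrow> std_mat A = 0\<^sub>m (dim_row A) (dim_col A)"
proof
  assume "std_mat A = 0\<^sub>m (dim_row A) (dim_col A)"
  then have "Dual (std_part (A $$ (i, j))) 0 = 0" if "i < dim_row A" "j < dim_col A" for i j
    using that by (metis index_std_mat(1) index_zero_mat(1))
  then show "infinitesimal A" by (auto simp: infinitesimal_def dual_eq_iff)
qed (auto simp: infinitesimal_def dual_eq_iff)

lemma infinitesimal_mult:
  "dim_col A = dim_row B \<Longrightarrow> infinitesimal A \<Longrightarrow> infinitesimal (A * B)"
  "dim_col A = dim_row B \<Longrightarrow> infinitesimal B \<Longrightarrow> infinitesimal (A * B)"
  by (auto simp: infinitesimal_iff std_mat_mult mat_mult_zero)

lemma infinitesimal_mult_infinitesimal: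
  "dim_col A = dim_row B \<Longrightarrow> infinitesimal A \<Longrightarrow> infinitesimal B \<Longrightarrow>
    A * B = 0\<^sub>m (dim_row A) (dim_col B)"
  by (rule eq_matI) (auto simp: infinitesimal_def scalar_prod_def dual_eq_iff)

lemma infinitesimal_add: "dim_row A = dim_row B \<Longrightarrow> dim_col A = dim_col B \<Longrightarrow>
    infinitesimal A \<Longrightarrow> infinitesimal B \<Longrightarrow> infinitesimal (A + B)"
  by (auto simp: infinitesimal_def)

lemma infinitesimal_adj: "infinitesimal A \<Longrightarrow> infinitesimal (A\<^sup>H)"
  by (auto simp: infinitesimal_def)

text \<open>The difference \<open>Y - Y'\<close> is infinitesimal, and two infinitesimal factors
  multiply to zero.\<close>

lemma infinitesimal_mult_cong:
  assumes "infinitesimal D" "std_mat Y = std_mat Y'"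
  shows "dim_col Y = dim_row D \<Longrightarrow> Y * D = Y' * D" "dim_row Y = dim_col D \<Longrightarrow> D * Y = D * Y'"
proof -
  have dims: "dim_row Y = dim_row Y'" "dim_col Y = dim_col Y'"
    using assms(2) dim_std_mat by metis+
  then have "infinitesimal (Y - Y')"
    using assms(2) by (auto simp: infinitesimal_iff std_simps)
  then have *: "dim_col Y = dim_row D \<Longrightarrow> (Y - Y') * D = 0\<^sub>m (dim_row Y) (dim_col D)"
    "dim_row Y = dim_col D \<Longrightarrow> D * (Y - Y') = 0\<^sub>m (dim_row D) (dim_col Y)"
    using assms(1) dims by (auto simp: infinitesimal_mult_infinitesimal)
  have zero: "A = B" if "A - B = 0\<^sub>m (dim_row A) (dim_col A)" "dim_row A = dim_row B"
    "dim_col A = dim_col B" for A B :: "dual_complex mat"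
    using that by (metis carrier_matI eq_iff_diff_eq_0 eq_matI index_minus_mat(1) index_zero_mat(1))
  show "Y * D = Y' * D" if "dim_col Y = dim_row D"
    by (rule zero) (use * dims that in \<open>auto simp: mat_simps\<close>)
  show "D * Y = D * Y'" if "dim_row Y = dim_col D"
    by (rule zero) (use * dims that in \<open>auto simp: mat_simps\<close>)
qed

section \<open>Essential parts and Moore-Penrose inverses\<close>

definition mp_inverse :: "dual_complex mat \<Rightarrow> dual_complex mat \<Rightarrow> bool" where
  "mp_inverse C X \<longleftrightarrow> X \<in> carrier_mat (dim_col C) (dim_row C) \<and>
     C * X * C = C \<and> X * C * X = X \<and> (C * X)\<^sup>H = C * X \<and> (X * C)\<^sup>H = X * C"

lemma mp_inverseD:
  assumes "mp_inverse C X"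
  shows "dim_row X = dim_col C" "dim_col X = dim_row C" "C * (X * C) = C" "X * (C * X) = X"
    "X\<^sup>H * C\<^sup>H = C * X" "C\<^sup>H * X\<^sup>H = X * C"
  using assms by (auto simp: mp_inverse_def adj_mult mat_assoc)

lemma mp_inverse_cancel:
  assumes "mp_inverse C X"
  shows "dim_row Z = dim_col C \<Longrightarrow> C * (X * (C * Z)) = C * Z"
    "dim_row Z = dim_row C \<Longrightarrow> X * (C * (X * Z)) = X * Z"
  using mp_inverseD[OF assms]
  by (simp_all flip: mat_assoc)

text \<open>Penrose's argument: \<open>C * X\<close> and \<open>C * Y\<close> are Hermitian
  idempotents that absorb each other, hence equal, and likewise \<open>X * C\<close> and
  \<open>Y * C\<close>. Then \<open>X = X * C * X = X * C * Y = Y * C * Y = Y\<close>.\<close>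

lemma mp_inverse_unique:
  assumes "mp_inverse C X" "mp_inverse C Y"
  shows "X = Y"
proof -
  note X = mp_inverseD[OF assms(1)] mp_inverse_cancel[OF assms(1)]
    and Y = mp_inverseD[OF assms(2)] mp_inverse_cancel[OF assms(2)]
  have "C * X = (C * Y * (C * X))\<^sup>H"
    using assms by (simp add: X Y mat_assoc mp_inverse_def)
  also have "\<dots> = (C * X) * (C * Y)"
    by (simp add: X Y adj_mult)
  also have "\<dots> = C * Y"
    by (simp add: X Y mat_assoc)
  finally have CX: "C * X = C * Y" .
  have "X * C = (X * C * (Y * C))\<^sup>H"
    using assms by (simp add: X Y mat_assoc mp_inverse_def)
  also have "\<dots> = (Y * C) * (X * C)"
    by (simp add: X Y adj_mult)
  also have "\<dots> = Y * C"
    by (simp add: X Y mat_assoc)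
  finally have XC: "X * C = Y * C" .
  have "X = X * (C * X)" by (simp add: X)
  also have "\<dots> = X * C * Y" by (simp add: X Y mat_assoc flip: CX)
  also have "\<dots> = Y" by (simp add: X Y mat_assoc XC)
  finally show ?thesis .
qed

text \<open>Taking standard parts is multiplicative and commutes with the adjoint, so the Penrose
  equations survive it.\<close>

lemma mp_inverse_std_mat: "mp_inverse C X \<Longrightarrow> mp_inverse (std_mat C) (std_mat X)"
  unfolding mp_inverse_def
  by (auto simp flip: std_mat_mult std_mat_adj)

text \<open>\<open>C\<close> is the essential part of \<open>A\<close> and \<open>X\<close> its NDMPI, expressed without an SVD.\<close>

definition ess_decomp :: "dual_complex mat \<Rightarrow> dual_complex mat \<Rightarrow> dual_complex mat \<Rightarrow> bool" where
  "ess_decomp A C X \<longleftrightarrow> mp_inverse C X \<and> (\<exists>D. D \<in> carrier_mat (dim_row C) (dim_col C) \<and> A = C + D \<and>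
     infinitesimal D \<and> X * D = 0\<^sub>m (dim_col C) (dim_col C) \<and> D * X = 0\<^sub>m (dim_row C) (dim_row C))"

text \<open>The standard parts of \<open>C\<close> and \<open>C'\<close> agree, hence also those of
  \<open>X\<close> and \<open>X'\<close> and of the complementary projectors. Compressing
  \<open>C + D = C' + D'\<close> by \<open>Q'\<close> and \<open>P'\<close> leaves \<open>D'\<close>
  on the right. On the left it leaves \<open>D\<close>, because next to the infinitesimal
  \<open>D\<close> the projectors may be exchanged for \<open>Q\<close> and \<open>P\<close>, and
  because \<open>Q' * C * P'\<close> vanishes.\<close>

lemma ess_decomp_unique_aux:
  assumes mp: "mp_inverse C X" "mp_inverse C' X'"
    and D: "D \<in> carrier_mat m n" "infinitesimal D" "X * D = 0\<^sub>m n n" "D * X = 0\<^sub>m m m"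
    and D': "D' \<in> carrier_mat m n" "infinitesimal D'" "X' * D' = 0\<^sub>m n n" "D' * X' = 0\<^sub>m m m"
    and C: "C \<in> carrier_mat m n" "C' \<in> carrier_mat m n" and eq: "C + D = C' + D'"
  shows "D = D'"
proof -
  note mpD = mp_inverseD[OF mp(1)] mp_inverseD[OF mp(2)]
  have dims [simp]: "dim_row C = m" "dim_col C = n" "dim_row C' = m" "dim_col C' = n"
    "dim_row D = m" "dim_col D = n" "dim_row D' = m" "dim_col D' = n"
    "dim_row X = n" "dim_col X = m" "dim_row X' = n" "dim_col X' = m"
    using C D D' mpD by auto
  have sC: "std_mat C = std_mat C'"
    using arg_cong[OF eq, of std_mat] D(2) D'(2)
    by (simp add: std_simps infinitesimal_iff) (metis dims dim_std_mat carrier_matI right_add_zero_mat)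
  then have sX: "std_mat X = std_mat X'"
    using mp mp_inverse_std_mat mp_inverse_unique by metis
  define Q P Q' P' where "Q = 1\<^sub>m m - C * X" "P = 1\<^sub>m n - X * C"
    "Q' = 1\<^sub>m m - C' * X'" "P' = 1\<^sub>m n - X' * C'"
  note QP = Q_P_Q'_P'_def
  have qd [simp]: "dim_row Q = m" "dim_col Q = m" "dim_row P = n" "dim_col P = n"
    "dim_row Q' = m" "dim_col Q' = m" "dim_row P' = n" "dim_col P' = n"
    by (auto simp: QP)
  have sQ: "std_mat Q = std_mat Q'" "std_mat P = std_mat P'"
    by (simp_all add: QP std_simps sC sX)
  have z: "Q * C = 0\<^sub>m m n" "C * P = 0\<^sub>m m n" "Q' * C' = 0\<^sub>m m n"
    using mpD by (simp_all add: QP mat_simps)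
  have QDP: "Q * D = D" "D * P = D" "Q' * D' = D'" "D' * P' = D'"
    using D(3,4) D'(3,4) by (simp_all add: QP mat_simps mat_mult_eq_left[OF D(4)]
        mat_mult_eq_left[OF D'(4)])
  \<comment> \<open>\<open>Q'\<close> and \<open>P'\<close> have the standard parts of
    \<open>Q\<close> and \<open>P\<close>, which annihilate \<open>C\<close>. Writing
    \<open>C\<close> as \<open>C * X * C\<close> then turns \<open>Q' * C * P'\<close> into a
    product with two infinitesimal factors.\<close>
  have "infinitesimal (Q' * C)" "infinitesimal (C * P')"
    using arg_cong[OF z(1), of std_mat] arg_cong[OF z(2), of std_mat]
    by (simp_all add: infinitesimal_iff std_simps sQ)
  then have "Q' * C * (X * (C * P')) = 0\<^sub>m m n"
    by (subst infinitesimal_mult_infinitesimal) (auto intro: infinitesimal_mult)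
  then have QCP: "Q' * (C * P') = 0\<^sub>m m n"
    using mpD by (simp add: mat_assoc[symmetric]) (simp add: mat_assoc)
  have "D' = Q' * ((C' + D') * P')"
    using QDP by (simp add: mat_simps mat_mult_eq_left[OF z(3)])
  also have "\<dots> = Q' * (D * P')"
    unfolding eq[symmetric] by (simp add: mat_simps QCP)
  also have "D * P' = D"
    using infinitesimal_mult_cong(2)[OF D(2) sQ(2)] QDP(2) by simp
  also have "Q' * D = D"
    using infinitesimal_mult_cong(1)[OF D(2) sQ(1)] QDP(1) by simp
  finally show ?thesis by simp
qed

lemma mat_add_right_cancel:
  fixes A B :: "'a :: ab_group_add mat"
  assumes "A \<in> carrier_mat m n" "B \<in> carrier_mat m n" "D \<in> carrier_mat m n" "A + D = B + D"
  shows "A = B"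
proof (rule eq_matI)
  show "A $$ (i, j) = B $$ (i, j)" if "i < dim_row B" "j < dim_col B" for i j
  proof -
    have "(A + D) $$ (i, j) = (B + D) $$ (i, j)" using assms(4) by simp
    then show ?thesis using assms(1-3) that by (subst (asm) (1 2) index_add_mat) auto
  qed
qed (use assms in auto)

lemma ess_decomp_unique:
  assumes "ess_decomp A C X" "ess_decomp A C' X'"
  shows "C = C'" "X = X'"
proof -
  from assms obtain D D' where D: "D \<in> carrier_mat (dim_row C) (dim_col C)" "A = C + D"
      "infinitesimal D" "X * D = 0\<^sub>m (dim_col C) (dim_col C)" "D * X = 0\<^sub>m (dim_row C) (dim_row C)"
    and D': "D' \<in> carrier_mat (dim_row C') (dim_col C')" "A = C' + D'"
      "infinitesimal D'" "X' * D' = 0\<^sub>m (dim_col C') (dim_col C')"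
      "D' * X' = 0\<^sub>m (dim_row C') (dim_row C')"
    and mp: "mp_inverse C X" "mp_inverse C' X'"
    by (auto simp: ess_decomp_def)
  have dims: "dim_row C' = dim_row C" "dim_col C' = dim_col C"
    using D D' by (metis carrier_matD index_add_mat(2,3))+
  have "D = D'"
    by (rule ess_decomp_unique_aux[of C X C' X' D "dim_row C" "dim_col C" D'])
       (use mp D D' dims in auto)
  then show "C = C'"
    using D D' dims by (intro mat_add_right_cancel[of C _ _ C' D]) auto
  with mp show "X = X'" using mp_inverse_unique by blast
qed

text \<open>\<open>A\<close> and \<open>C\<close> have the same products with \<open>X\<close>, so
  \<open>X\<close> solves the defining equations. Conversely, for a solution \<open>Y\<close> the
  equation \<open>C = A * Y * A\<close> gives \<open>C * Y = A * Y\<close> and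
  \<open>Y * C = Y * A\<close>, which makes \<open>Y\<close> a Moore-Penrose inverse of
  \<open>C\<close>.\<close>

lemma ess_decomp_ndmpi:
  assumes "ess_decomp A C X" "essential_part A = C"
  shows "ndmpi A = X"
proof -
  from assms obtain D where D: "D \<in> carrier_mat (dim_row C) (dim_col C)" "A = C + D"
      "infinitesimal D" "X * D = 0\<^sub>m (dim_col C) (dim_col C)" "D * X = 0\<^sub>m (dim_row C) (dim_row C)"
    and mp: "mp_inverse C X"
    by (auto simp: ess_decomp_def)
  note X = mp_inverseD[OF mp]
  have dims: "dim_row A = dim_row C" "dim_col A = dim_col C" "dim_row D = dim_row C"
    "dim_col D = dim_col C"
    using D by auto
  have AX: "A * X = C * X" "X * A = X * C"
    using D X dims by (simp_all add: mat_simps)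
  have "is_ndmpi A X"
  proof -
    have "A * X * A = C"
      using X dims AX by (simp add: mat_assoc)
    then show ?thesis
      using AX mp assms(2) dims by (simp add: is_ndmpi_def mp_inverse_def)
  qed
  moreover have "Y = X" if "is_ndmpi A Y" for Y
  proof -
    have Y: "dim_row Y = dim_col C" "dim_col Y = dim_row C" "A * (Y * A) = C" "Y * (A * Y) = Y"
      "(A * Y)\<^sup>H = A * Y" "(Y * A)\<^sup>H = Y * A"
      using that assms dims by (auto simp: is_ndmpi_def mat_assoc)
    have "C * Y = A * (Y * A) * Y" using Y(3) by simp
    then have CY: "C * Y = A * Y" using Y(1,2,4) dims by (simp add: mat_assoc)
    have "Y * C = Y * (A * Y) * A" unfolding Y(3)[symmetric] using Y(1,2) dims by (simp add: mat_assoc)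
    then have YC: "Y * C = Y * A" using Y(4) by simp
    have "mp_inverse C Y"
      unfolding mp_inverse_def CY YC
    proof (intro conjI)
      have "A * Y * C = A * (Y * A)" using Y dims YC by (simp add: mat_assoc)
      then show "A * Y * C = C" using Y by simp
      show "Y * A * Y = Y" using Y dims by (simp add: mat_assoc)
    qed (use Y in auto)
    then show ?thesis using mp mp_inverse_unique by blast
  qed
  ultimately show ?thesis
    unfolding ndmpi_def by blast
qed

section \<open>From a singular value decomposition to the essential part\<close>

lemma unitary_dualD:
  assumes "unitary_dual U"
  shows "dim_row U = dim_col U" "U\<^sup>H * U = 1\<^sub>m (dim_col U)" "U * U\<^sup>H = 1\<^sub>m (dim_col U)"
    "dim_row Z = dim_col U \<Longrightarrow> U\<^sup>H * (U * Z) = Z" "dim_row Z = dim_col U \<Longrightarrow> U * (U\<^sup>H * Z) = Z"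
  using assms by (auto simp: unitary_dual_def simp flip: mat_assoc)

lemma unitary_dualI:
  "U \<in> carrier_mat n n \<Longrightarrow> U\<^sup>H * U = 1\<^sub>m n \<Longrightarrow> U * U\<^sup>H = 1\<^sub>m n \<Longrightarrow> unitary_dual U"
  by (auto simp: unitary_dual_def)

lemma mp_inverse_unitary:
  assumes U: "U \<in> carrier_mat m m" "unitary_dual U" and V: "V \<in> carrier_mat n n" "unitary_dual V"
    and C: "C \<in> carrier_mat m n" "mp_inverse C X"
  shows "mp_inverse (U * C * V\<^sup>H) (V * X * U\<^sup>H)"
proof -
  note X = mp_inverseD[OF C(2)] mp_inverse_cancel[OF C(2)]
  have [simp]: "dim_row U = m" "dim_col U = m" "dim_row V = n" "dim_col V = n"
    "dim_row C = m" "dim_col C = n" "dim_row X = n" "dim_col X = m"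
    using U V C X by auto
  show ?thesis
    unfolding mp_inverse_def
    by (intro conjI carrier_matI)
       (simp_all add: mat_assoc adj_mult unitary_dualD(2-)[OF U(2)] unitary_dualD(2-)[OF V(2)] X)
qed

lemma ess_decomp_unitary:
  assumes U: "U \<in> carrier_mat m m" "unitary_dual U" and V: "V \<in> carrier_mat n n" "unitary_dual V"
    and C: "C \<in> carrier_mat m n" "ess_decomp A C X"
  shows "ess_decomp (U * A * V\<^sup>H) (U * C * V\<^sup>H) (V * X * U\<^sup>H)"
proof -
  from C obtain D where D: "D \<in> carrier_mat m n" "A = C + D"
      "infinitesimal D" "X * D = 0\<^sub>m n n" "D * X = 0\<^sub>m m m"
    and mp: "mp_inverse C X"
    by (auto simp: ess_decomp_def)
  note X = mp_inverseD[OF mp] mp_inverse_cancel[OF mp]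
  have [simp]: "dim_row U = m" "dim_col U = m" "dim_row V = n" "dim_col V = n"
    "dim_row C = m" "dim_col C = n" "dim_row X = n" "dim_col X = m" "dim_row D = m" "dim_col D = n"
    using U V C X D by auto
  have "mp_inverse (U * C * V\<^sup>H) (V * X * U\<^sup>H)"
    using mp_inverse_unitary[OF U V C(1) mp] .
  moreover have "U * A * V\<^sup>H = U * C * V\<^sup>H + U * D * V\<^sup>H"
    by (simp add: D(2) mat_simps)
  moreover have "infinitesimal (U * D * V\<^sup>H)"
    using D(3) by (simp add: infinitesimal_mult)
  moreover have "V * X * U\<^sup>H * (U * D * V\<^sup>H) = 0\<^sub>m n n"
    by (simp add: unitary_dualD(2-)[OF U(2)] mat_simps mat_mult_eq_left[OF D(4)])
  moreover have "U * D * V\<^sup>H * (V * X * U\<^sup>H) = 0\<^sub>m m m"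
    by (simp add: unitary_dualD(2-)[OF V(2)] mat_simps mat_mult_eq_left[OF D(5)])
  ultimately show ?thesis
    unfolding ess_decomp_def by (intro conjI exI[of _ "U * D * V\<^sup>H"]) auto
qed

text \<open>The diagonal is a function on all naturals, so one definition covers every rectangular
  shape and prepending an entry is just \<open>case_nat\<close>.\<close>

definition dg :: "nat \<Rightarrow> nat \<Rightarrow> (nat \<Rightarrow> 'a :: zero) \<Rightarrow> 'a mat" where
  "dg m n f = mat m n (\<lambda>(i, j). if i = j then f i else 0)"

lemma dim_dg [simp]: "dim_row (dg m n f) = m" "dim_col (dg m n f) = n"
  by (auto simp: dg_def)

lemma index_dg [simp]: "i < m \<Longrightarrow> j < n \<Longrightarrow> dg m n f $$ (i, j) = (if i = j then f i else 0)"
  by (auto simp: dg_def)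

text \<open>A row index \<open>i \<ge> n\<close> has no partner among the \<open>n\<close> middle
  indices, hence the zero.\<close>

lemma dg_mult:
  fixes f :: "nat \<Rightarrow> 'a :: semiring_0"
  shows "dg m n f * dg n p g = dg m p (\<lambda>i. if i < n then f i * g i else 0)"
  by (rule eq_matI) (auto simp: scalar_prod_def if_distrib[of "\<lambda>x. x * _"] sum.delta cong: if_cong)

lemma adj_dg: "(dg m n f)\<^sup>H = dg n m (\<lambda>i. conjugate (f i))"
  by (rule eq_matI) auto

lemma diagonal_mat_eq_dg: "diagonal_mat A \<Longrightarrow> A = dg (dim_row A) (dim_col A) (\<lambda>i. A $$ (i, i))"
  by (rule eq_matI) (auto simp: diagonal_mat_def)

lemma dg_one: "(\<And>i. i < n \<Longrightarrow> f i = 1) \<Longrightarrow> dg n n f = 1\<^sub>m n"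
  by (rule eq_matI) auto

lemma adj_four_block_mat:
  assumes "A \<in> carrier_mat a b" "B \<in> carrier_mat a d" "C \<in> carrier_mat c b" "D \<in> carrier_mat c d"
  shows "(four_block_mat A B C D)\<^sup>H = four_block_mat A\<^sup>H C\<^sup>H B\<^sup>H D\<^sup>H"
  using assms by (intro eq_matI) auto

text \<open>The expansion of 1 / (s + d eps) as 1 / s - (d / s^2) eps.\<close>

definition dual_inv :: "dual_complex \<Rightarrow> dual_complex" where
  "dual_inv a = Dual (1 / std_part a) (- inf_part a / (std_part a)\<^sup>2)"

lemma dual_inv: "std_part a \<noteq> 0 \<Longrightarrow> a * dual_inv a = 1" "std_part a \<noteq> 0 \<Longrightarrow> dual_inv a * a = 1"
  by (auto simp: dual_inv_def dual_eq_iff field_simps power2_eq_square)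

text \<open>The inverse of \<open>S1\<close>, padded with zeros, is the Moore-Penrose inverse of the
  padded \<open>S1\<close>. The block \<open>S2\<close> sits in the complementary corner, so the
  padded inverse annihilates it from both sides.\<close>

lemma ess_decomp_block:
  assumes S1: "S1 \<in> carrier_mat r r" "diagonal_mat S1" "\<And>i. i < r \<Longrightarrow> std_part (S1 $$ (i, i)) \<noteq> 0"
    and S2: "S2 \<in> carrier_mat p q" "infinitesimal S2"
  shows "\<exists>X. ess_decomp (four_block_mat S1 (0\<^sub>m r q) (0\<^sub>m p r) S2)
    (four_block_mat S1 (0\<^sub>m r q) (0\<^sub>m p r) (0\<^sub>m p q)) X"
proof -
  define T where "T = dg r r (\<lambda>i. dual_inv (S1 $$ (i, i)))"
  have T: "T \<in> carrier_mat r r" by (auto simp: T_def)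
  have S1dg: "S1 = dg r r (\<lambda>i. S1 $$ (i, i))"
    using diagonal_mat_eq_dg[OF S1(2)] S1(1) by simp
  have ST: "S1 * T = 1\<^sub>m r" "T * S1 = 1\<^sub>m r"
    by (subst S1dg, auto simp: T_def dg_mult dual_inv S1(3) intro!: dg_one)+
  note [simp] = carrier_matD[OF S1(1)] carrier_matD[OF S2(1)] carrier_matD[OF T]
  define X where "X = four_block_mat T (0\<^sub>m r p) (0\<^sub>m q r) (0\<^sub>m q p)"
  define C where "C = four_block_mat S1 (0\<^sub>m r q) (0\<^sub>m p r) (0\<^sub>m p q)"
  define D where "D = four_block_mat (0\<^sub>m r r) (0\<^sub>m r q) (0\<^sub>m p r) S2"
  have CX: "C * X = four_block_mat (1\<^sub>m r) (0\<^sub>m r p) (0\<^sub>m p r) (0\<^sub>m p p)"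
    unfolding C_def X_def
    by (subst mult_four_block_mat[of _ r r _ q _ p _ _ r _ p]) (use S1 T ST in \<open>auto simp: mat_simps\<close>)
  have XC: "X * C = four_block_mat (1\<^sub>m r) (0\<^sub>m r q) (0\<^sub>m q r) (0\<^sub>m q q)"
    unfolding C_def X_def
    by (subst mult_four_block_mat[of _ r r _ p _ q _ _ r _ q]) (use S1 T ST in \<open>auto simp: mat_simps\<close>)
  have CXC: "C * X * C = C"
    unfolding CX unfolding C_def
    by (subst mult_four_block_mat[of _ r r _ p _ p _ _ r _ q]) (use S1 T ST in \<open>auto simp: mat_simps\<close>)
  have XCX: "X * C * X = X"
    unfolding XC unfolding X_def
    by (subst mult_four_block_mat[of _ r r _ q _ q _ _ r _ p]) (use S1 T ST in \<open>auto simp: mat_simps\<close>)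
  have mp: "mp_inverse C X"
    unfolding mp_inverse_def
  proof (intro conjI CXC XCX)
    show "(C * X)\<^sup>H = C * X" unfolding CX by (subst adj_four_block_mat[of _ r r _ p _ p]) auto
    show "(X * C)\<^sup>H = X * C" unfolding XC by (subst adj_four_block_mat[of _ r r _ q _ q]) auto
  qed (auto simp: C_def X_def)
  moreover have "D \<in> carrier_mat (r + p) (r + q)"
    by (auto simp: D_def)
  moreover have "four_block_mat S1 (0\<^sub>m r q) (0\<^sub>m p r) S2 = C + D"
    unfolding C_def D_def by (rule eq_matI) auto
  moreover have "infinitesimal D"
    using S2 by (auto simp: D_def infinitesimal_def)
  moreover have "X * D = 0\<^sub>m (r + q) (r + q)"
    unfolding X_def D_def
    by (subst mult_four_block_mat[of _ r r _ p _ q _ _ r _ q])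
       (use S2 T in \<open>auto simp: mat_simps intro!: eq_matI\<close>)
  moreover have "D * X = 0\<^sub>m (r + p) (r + p)"
    unfolding X_def D_def
    by (subst mult_four_block_mat[of _ r r _ q _ p _ _ r _ p])
       (use S2 T in \<open>auto simp: mat_simps intro!: eq_matI\<close>)
  moreover have "dim_row C = r + p" "dim_col C = r + q"
    by (auto simp: C_def)
  ultimately have "ess_decomp (four_block_mat S1 (0\<^sub>m r q) (0\<^sub>m p r) S2) C X"
    unfolding ess_decomp_def by (intro conjI exI[of _ D]) auto
  then show ?thesis unfolding C_def by blast
qed

text \<open>The block case is carried over by the two unitary factors. As this applies to every SVD,
  uniqueness of the decomposition will show that the truncated matrix is the same for all of
  them.\<close>

lemma is_dual_svd_ess_decomp:
  assumes "is_dual_svd A r U S1 S2 V"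
  shows "\<exists>X. ess_decomp A (U * four_block_mat S1 (0\<^sub>m r (dim_col A - r))
                  (0\<^sub>m (dim_row A - r) r) (0\<^sub>m (dim_row A - r) (dim_col A - r))
              * V\<^sup>H) X"
proof -
  define m n where "m = dim_row A" "n = dim_col A"
  have *: "r \<le> m" "r \<le> n" "U \<in> carrier_mat m m" "unitary_dual U"
    "V \<in> carrier_mat n n" "unitary_dual V" "S1 \<in> carrier_mat r r" "diagonal_mat S1"
    "\<And>i. i < r \<Longrightarrow> positive_appreciable (S1 $$ (i, i))"
    "S2 \<in> carrier_mat (m - r) (n - r)" "diagonal_mat S2"
    "\<And>i. i < min (m - r) (n - r) \<Longrightarrow> positive_infinitesimal (S2 $$ (i, i)) \<or> S2 $$ (i, i) = 0"
    "A = U * four_block_mat S1 (0\<^sub>m r (n - r)) (0\<^sub>m (m - r) r) S2 * V\<^sup>H"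
    using assms by (auto simp: is_dual_svd_def Let_def m_n_def)
  have "std_part (S1 $$ (i, i)) \<noteq> 0" if "i < r" for i
    using *(9)[OF that] by (auto simp: positive_appreciable_def)
  moreover have "infinitesimal S2"
    unfolding infinitesimal_def
  proof (intro allI impI)
    fix i j assume "i < dim_row S2" "j < dim_col S2"
    then show "std_part (S2 $$ (i, j)) = 0"
      using *(10-11) *(12)[of i]
      by (cases "i = j") (auto simp: diagonal_mat_def positive_infinitesimal_def)
  qed
  ultimately obtain X where "ess_decomp (four_block_mat S1 (0\<^sub>m r (n - r)) (0\<^sub>m (m - r) r) S2)
    (four_block_mat S1 (0\<^sub>m r (n - r)) (0\<^sub>m (m - r) r) (0\<^sub>m (m - r) (n - r))) X"
    using ess_decomp_block *(7,8,10) by blast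
  moreover have "four_block_mat S1 (0\<^sub>m r (n - r)) (0\<^sub>m (m - r) r) (0\<^sub>m (m - r) (n - r)) \<in> carrier_mat m n"
    using *(1,2,7) by (intro carrier_matI) auto
  ultimately have "ess_decomp A (U * four_block_mat S1 (0\<^sub>m r (n - r)) (0\<^sub>m (m - r) r)
      (0\<^sub>m (m - r) (n - r)) * V\<^sup>H) (V * X * U\<^sup>H)"
    using ess_decomp_unitary[OF *(3-6)] by (subst *(13))
  then show ?thesis
    unfolding m_n_def[symmetric] ..
qed

section \<open>Products\<close>

text \<open>The point is \<open>P Q = P Q P\<close>, whose right-hand side is Hermitian.\<close>

lemma commute_mp_inverse:
  assumes "dim_row H = n" "dim_col H = n" "dim_row G = n" "dim_col G = n" "dim_row Q = n" "dim_col Q = n"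
    and GH: "G * H = P" and HG: "H * G = P" and HP: "H * P = H" and PG: "P * G = G"
    and PH: "P\<^sup>H = P" and QH: "Q\<^sup>H = Q" and com: "Q * H = H * Q"
  shows "P * Q = Q * P" "G * Q = Q * G"
proof -
  have [simp]: "dim_row H = n" "dim_col H = n" "dim_row G = n" "dim_col G = n" "dim_row Q = n" "dim_col Q = n"
    "dim_row P = n" "dim_col P = n"
    using assms by (auto simp flip: GH)
  have GP: "G * P = G"
    unfolding HG[symmetric] by (simp add: PG GH flip: mat_assoc)
  have PQ: "P * Q = P * (Q * P)"
  proof -
    \<comment> \<open>\<open>P = G * H\<close>; moving \<open>Q\<close> across \<open>H\<close>
      exposes the right end of \<open>H\<close>, which absorbs \<open>P\<close>.\<close>
    have "P * Q = G * (Q * H)" unfolding com by (simp flip: GH add: mat_assoc)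
    also have "\<dots> = G * (Q * H * P)" by (simp add: mat_assoc HP)
    also have "\<dots> = P * (Q * P)" unfolding com by (simp flip: GH add: mat_assoc)
    finally show ?thesis .
  qed
  also have "P * (Q * P) = Q * P"
    using arg_cong[OF PQ, of adj] by (simp add: adj_mult PH QH mat_assoc)
  finally show PQ': "P * Q = Q * P" .
  \<comment> \<open>\<open>P\<close> is inserted, moved behind \<open>Q\<close> and read as
    \<open>H * G\<close>, so that \<open>Q\<close> can pass from the left of \<open>H\<close> to its
    right.\<close>
  have "G * Q = G * (P * Q)" by (simp add: GP flip: mat_assoc)
  also have "\<dots> = G * (Q * H * G)" unfolding PQ' by (simp flip: HG add: mat_assoc)
  also have "\<dots> = G * H * (Q * G)" unfolding com by (simp add: mat_assoc)
  also have "\<dots> = Q * (P * G)" unfolding GH by (simp add: PQ' flip: mat_assoc)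
  finally show "G * Q = Q * G" unfolding PG .
qed

section \<open>Gram matrices and their Moore-Penrose inverses\<close>

lemma mp_inverse_adj:
  assumes "mp_inverse C X"
  shows "mp_inverse (C\<^sup>H) (X\<^sup>H)"
  unfolding mp_inverse_def
proof (intro conjI)
  note X = mp_inverseD[OF assms]
  show "C\<^sup>H * X\<^sup>H * C\<^sup>H = C\<^sup>H" "X\<^sup>H * C\<^sup>H * X\<^sup>H = X\<^sup>H"
    using arg_cong[OF X(3), of adj] arg_cong[OF X(4), of adj] X(1,2) by (simp_all add: adj_mult)
  show "(C\<^sup>H * X\<^sup>H)\<^sup>H = C\<^sup>H * X\<^sup>H" "(X\<^sup>H * C\<^sup>H)\<^sup>H = X\<^sup>H * C\<^sup>H"
    unfolding X using assms by (auto simp: mp_inverse_def)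
qed (use mp_inverseD(1,2)[OF assms] in auto)

text \<open>\<open>X * X\<^sup>H\<close> is the Moore-Penrose inverse of
  \<open>C\<^sup>H * C\<close>, and both products of the two are the projector \<open>X * C\<close>.
  These are the facts that \<open>commute_mp_inverse\<close> asks for.\<close>

lemma gram_mp_inverse:
  assumes "mp_inverse C X"
  shows "X * X\<^sup>H * (C\<^sup>H * C) = X * C" "C\<^sup>H * C * (X * X\<^sup>H) = X * C"
    "C\<^sup>H * C * (X * C) = C\<^sup>H * C" "X * C * (X * X\<^sup>H) = X * X\<^sup>H" "X * X\<^sup>H * C\<^sup>H = X"
proof -
  note X [simp] = mp_inverseD(1-4)[OF assms] mp_inverse_cancel[OF assms]
  note h = mp_inverseD(5,6)[OF assms]
  note hl = h[THEN mat_mult_eq_left]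
  show "X * X\<^sup>H * (C\<^sup>H * C) = X * C" by (simp add: mat_assoc hl)
  show "C\<^sup>H * C * (X * C) = C\<^sup>H * C" "X * C * (X * X\<^sup>H) = X * X\<^sup>H" "X * X\<^sup>H * C\<^sup>H = X"
    by (simp_all add: mat_assoc h)
  have "C * (X * X\<^sup>H) = X\<^sup>H * C\<^sup>H * X\<^sup>H"
    unfolding h by (simp add: mat_assoc)
  then have "C * (X * X\<^sup>H) = X\<^sup>H"
    using mp_inverseD(4)[OF mp_inverse_adj[OF assms]] by (simp add: mat_assoc)
  then show "C\<^sup>H * C * (X * X\<^sup>H) = X * C" by (simp add: mat_assoc h)
qed

text \<open>The cross terms of the Gram matrix vanish: \<open>C\<^sup>H\<close> absorbs the
  Hermitian projector \<open>C * X\<close> on its right, and \<open>X * D = 0\<close>.\<close>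

lemma ess_decomp_gram:
  assumes "ess_decomp A C X"
  shows "A\<^sup>H * A = C\<^sup>H * C" "X * A = X * C" "A * X = C * X"
proof -
  from assms obtain D where D: "D \<in> carrier_mat (dim_row C) (dim_col C)" "A = C + D"
      "infinitesimal D" "X * D = 0\<^sub>m (dim_col C) (dim_col C)" "D * X = 0\<^sub>m (dim_row C) (dim_row C)"
    and mp: "mp_inverse C X"
    by (auto simp: ess_decomp_def)
  note X [simp] = mp_inverseD(1-4)[OF mp]
  have [simp]: "dim_row D = dim_row C" "dim_col D = dim_col C" using D by auto
  show XA: "X * A = X * C" "A * X = C * X"
    using D by (simp_all add: mat_simps)
  have "C\<^sup>H * D = C\<^sup>H * (X\<^sup>H * C\<^sup>H) * D"
    using mp_inverseD(3)[OF mp_inverse_adj[OF mp]] by simp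
  also have "\<dots> = 0\<^sub>m (dim_col C) (dim_col C)"
    unfolding mp_inverseD(5)[OF mp] by (simp add: mat_simps D)
  finally have CD: "C\<^sup>H * D = 0\<^sub>m (dim_col C) (dim_col C)" .
  have DC: "D\<^sup>H * C = 0\<^sub>m (dim_col C) (dim_col C)"
    using arg_cong[OF CD, of adj] by (simp add: adj_mult)
  have "D\<^sup>H * D = 0\<^sub>m (dim_col C) (dim_col C)"
    using infinitesimal_mult_infinitesimal[OF _ infinitesimal_adj[OF D(3)] D(3)] by simp
  then show "A\<^sup>H * A = C\<^sup>H * C"
    by (simp add: D(2) adj_add mat_simps CD DC)
qed

text \<open>Transfers the results on \<open>A\<^sup>H * A\<close> to products of the form
  \<open>B * B\<^sup>H\<close>.\<close>

lemma ess_decomp_adj: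
  assumes "ess_decomp A C X"
  shows "ess_decomp (A\<^sup>H) (C\<^sup>H) (X\<^sup>H)"
proof -
  from assms obtain D where D: "D \<in> carrier_mat (dim_row C) (dim_col C)" "A = C + D"
      "infinitesimal D" "X * D = 0\<^sub>m (dim_col C) (dim_col C)" "D * X = 0\<^sub>m (dim_row C) (dim_row C)"
    and mp: "mp_inverse C X"
    by (auto simp: ess_decomp_def)
  note X [simp] = mp_inverseD(1,2)[OF mp]
  have [simp]: "dim_row D = dim_row C" "dim_col D = dim_col C" using D by auto
  show ?thesis
    unfolding ess_decomp_def
    by (intro conjI mp_inverse_adj mp exI[of _ "D\<^sup>H"])
       (use D in \<open>auto simp: adj_add infinitesimal_adj simp flip: adj_mult\<close>)
qed

lemma ess_decomp_mult:
  assumes A: "A \<in> carrier_mat m q" "ess_decomp A C X"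
    and B: "B \<in> carrier_mat q n" "ess_decomp B E Y"
    and c1: "X * A * B * B\<^sup>H * A\<^sup>H = B * B\<^sup>H * C\<^sup>H"
    and c2: "B * Y * A\<^sup>H * A * B = A\<^sup>H * A * E"
  shows "ess_decomp (A * B) (C * E) (Y * X)"
proof -
  from A obtain D where D: "D \<in> carrier_mat (dim_row C) (dim_col C)" "A = C + D"
      "infinitesimal D" "X * D = 0\<^sub>m (dim_col C) (dim_col C)" "D * X = 0\<^sub>m (dim_row C) (dim_row C)"
    and mpC: "mp_inverse C X"
    by (auto simp: ess_decomp_def)
  from B obtain F where F: "F \<in> carrier_mat (dim_row E) (dim_col E)" "B = E + F"
      "infinitesimal F" "Y * F = 0\<^sub>m (dim_col E) (dim_col E)" "F * Y = 0\<^sub>m (dim_row E) (dim_row E)"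
    and mpE: "mp_inverse E Y"
    by (auto simp: ess_decomp_def)
  have dims [simp]: "dim_row A = m" "dim_col A = q" "dim_row B = q" "dim_col B = n"
    "dim_row C = m" "dim_col C = q" "dim_row E = q" "dim_col E = n"
    "dim_row D = m" "dim_col D = q" "dim_row F = q" "dim_col F = n"
    "dim_row X = q" "dim_col X = m" "dim_row Y = n" "dim_col Y = q"
    using A(1) B(1) D(1,2) F(1,2) mp_inverseD(1,2)[OF mpC] mp_inverseD(1,2)[OF mpE] by auto
  note XD = D(4)[unfolded dims] and DX = D(5)[unfolded dims]
    and YF = F(4)[unfolded dims] and FY = F(5)[unfolded dims]
  define P Q H K where "P = X * C" "Q = E * Y" "H = C\<^sup>H * C" "K = E * E\<^sup>H"
  note PQ = P_Q_H_K_def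
  have [simp]: "dim_row P = q" "dim_col P = q" "dim_row Q = q" "dim_col Q = q"
    "dim_row H = q" "dim_col H = q" "dim_row K = q" "dim_col K = q"
    by (auto simp: PQ)
  have herm: "P\<^sup>H = P" "Q\<^sup>H = Q" "H\<^sup>H = H" "K\<^sup>H = K"
    using mpC mpE by (auto simp: PQ adj_mult mp_inverse_def)
  have AP: "X * A = P" "A\<^sup>H * X\<^sup>H = P" "C\<^sup>H * X\<^sup>H = P" "A\<^sup>H * A = H"
    using ess_decomp_gram[OF A(2)] herm by (simp_all add: PQ flip: adj_mult)
  have BQ: "B * Y = Q" "B * B\<^sup>H = K"
    using ess_decomp_gram[OF B(2)] ess_decomp_gram(1)[OF ess_decomp_adj[OF B(2)]] by (simp_all add: PQ)
  have "P * (K * A\<^sup>H) = K * C\<^sup>H"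
    using c1 unfolding AP BQ by (simp add: mat_assoc BQ mat_mult_eq_left[OF BQ(2)])
  \<comment> \<open>Right multiplication by \<open>X\<^sup>H\<close> turns both
    \<open>A\<^sup>H\<close> and \<open>C\<^sup>H\<close> into \<open>P\<close>. The left-hand side
    becomes the Hermitian \<open>P * K * P\<close>, so \<open>K * P\<close> is Hermitian too, and
    that is commutation.\<close>
  then have "P * (K * A\<^sup>H) * X\<^sup>H = K * C\<^sup>H * X\<^sup>H" by simp
  then have PKP: "P * (K * P) = K * P" by (simp add: mat_assoc AP)
  have "P * (K * P) = P * K"
    using arg_cong[OF PKP, of adj] by (simp add: adj_mult herm mat_assoc)
  then have comPK: "P * K = K * P" using PKP by simp
  have "Q * (H * B) = H * E"
    using c2 unfolding BQ AP by (simp add: mat_assoc AP mat_mult_eq_left[OF AP(4)])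
  \<comment> \<open>Likewise \<open>Y\<close> turns both \<open>B\<close> and \<open>E\<close> into
    \<open>Q\<close>.\<close>
  then have "Q * (H * B) * Y = H * E * Y" by simp
  then have QHQ: "Q * (H * Q) = H * Q" by (simp add: mat_assoc BQ flip: PQ(2))
  have "Q * (H * Q) = Q * H"
    using arg_cong[OF QHQ, of adj] by (simp add: adj_mult herm mat_assoc)
  then have comQH: "Q * H = H * Q" using QHQ by simp
  note gC = gram_mp_inverse[OF mpC, folded PQ]
  \<comment> \<open>For \<open>E\<^sup>H\<close> with inverse \<open>Y\<^sup>H\<close> the Gram
    matrix is \<open>K\<close>, its inverse \<open>Y\<^sup>H * Y\<close> and the projector
    \<open>Q\<close>.\<close>
  note gE = gram_mp_inverse[OF mp_inverse_adj[OF mpE], simplified,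
      folded PQ, unfolded mp_inverseD(5)[OF mpE], folded PQ]
  have comPQ: "P * Q = Q * P" and comGQ: "X * X\<^sup>H * Q = Q * (X * X\<^sup>H)"
    by (rule commute_mp_inverse[of H q "X * X\<^sup>H" Q P]; use gC herm comQH in simp)+
  have comLP: "Y\<^sup>H * Y * P = P * (Y\<^sup>H * Y)"
    by (rule commute_mp_inverse[of K q "Y\<^sup>H * Y" P Q]; use gE herm comPK in simp)
  have PX: "P * X = X" "C * P = C" "Q * E = E" "Y * Q = Y"
    using mp_inverseD(3,4)[OF mpC] mp_inverseD(3,4)[OF mpE] by (simp_all add: PQ mat_assoc)
  note comPQl = mat_mult_eq_left[OF comPQ]
  have CZ: "C * E * (Y * X) = C * (Q * X)" by (simp add: PQ mat_assoc)
  have ZC: "Y * X * (C * E) = Y * (P * E)" by (simp add: PQ mat_assoc)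
  have "mp_inverse (C * E) (Y * X)"
    unfolding mp_inverse_def CZ ZC
  proof (intro conjI)
    have "C * (Q * X) * (C * E) = C * (Q * (P * E))" by (simp add: PQ mat_assoc)
    also have "\<dots> = C * P * (Q * E)"
      by (simp add: mat_assoc comPQl)
    finally show "C * (Q * X) * (C * E) = C * E" by (simp add: PX)
    have "Y * (P * E) * (Y * X) = Y * (P * (Q * X))" by (simp add: PQ mat_assoc)
    also have "\<dots> = Y * Q * (P * X)" by (simp add: mat_assoc comPQl)
    finally show "Y * (P * E) * (Y * X) = Y * X" by (simp add: PX)
    \<comment> \<open>Writing \<open>X\<close> as \<open>X * X\<^sup>H * C\<^sup>H\<close> makes the
      expression symmetric around \<open>Q * (X * X\<^sup>H)\<close>, a product of commuting
      Hermitian matrices. The second product is treated in the same way with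
      \<open>Y\<^sup>H * Y\<close> and \<open>P\<close>.\<close>
    have "C * (Q * X) = C * (Q * (X * X\<^sup>H)) * C\<^sup>H"
      using gC(5) by (simp add: mat_assoc)
    also have "\<dots>\<^sup>H = C * (X * X\<^sup>H * Q) * C\<^sup>H" by (simp add: adj_mult herm mat_assoc)
    also have "\<dots> = C * (Q * (X * X\<^sup>H)) * C\<^sup>H" unfolding comGQ ..
    also have "\<dots> = C * (Q * X)" using gC(5) by (simp add: mat_assoc)
    finally show "(C * (Q * X))\<^sup>H = C * (Q * X)" .
    have Y: "E\<^sup>H * (Y\<^sup>H * Y) = Y"
      using mp_inverseD(4,6)[OF mpE] by (simp add: mat_assoc flip: mat_assoc[of "E\<^sup>H" "Y\<^sup>H" Y])
    have YPE: "Y * (P * E) = E\<^sup>H * (Y\<^sup>H * Y * P) * E"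
      using mat_mult_eq_left[OF Y, of "P * E"] by (simp add: mat_assoc)
    also have "\<dots>\<^sup>H = E\<^sup>H * (P * (Y\<^sup>H * Y)) * E" by (simp add: adj_mult herm mat_assoc)
    also have "\<dots> = E\<^sup>H * (Y\<^sup>H * Y * P) * E" unfolding comLP ..
    finally show "(Y * (P * E))\<^sup>H = Y * (P * E)" unfolding YPE .
  qed auto
  moreover have "\<exists>W. W \<in> carrier_mat m n \<and> A * B = C * E + W \<and> infinitesimal W \<and>
    Y * X * W = 0\<^sub>m n n \<and> W * (Y * X) = 0\<^sub>m m m"
  \<comment> \<open>The remainder in the expansion of \<open>(C + D) * (E + F)\<close>. Two of the
    four products with \<open>Y * X\<close> vanish at once. In the others \<open>Y = Y * Q\<close>
    or \<open>X = P * X\<close> supplies a projector, and swapping \<open>P\<close> and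
    \<open>Q\<close> brings it next to \<open>F\<close> or \<open>D\<close>, which it
    annihilates.\<close>
  proof (intro exI[of _ "C * F + D * B"] conjI)
    show "A * B = C * E + (C * F + D * B)"
      unfolding D(2) F(2)
      by (rule eq_matI) (simp_all add: mat_simps ac_simps del: index_mult_mat(1))
    show "infinitesimal (C * F + D * B)"
      using D F by (simp add: infinitesimal_add infinitesimal_mult)
    have "Y * (X * (C * F)) = Y * (P * F)" by (simp add: PQ mat_assoc)
    also have "\<dots> = Y * Q * (P * F)" by (simp add: PX)
    also have "\<dots> = Y * (P * (Q * F))" by (simp add: mat_assoc comPQl)
    also have "\<dots> = 0\<^sub>m n n" by (simp add: PQ mat_simps YF)
    finally show "Y * X * (C * F + D * B) = 0\<^sub>m n n"
      by (simp add: mat_simps mat_mult_eq_left[OF XD])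
    have "D * (B * (Y * X)) = D * (Q * X)" by (simp add: mat_mult_eq_left[OF BQ(1)])
    also have "\<dots> = D * (Q * (P * X))" by (simp add: PX)
    also have "\<dots> = D * (P * (Q * X))" by (simp add: comPQl mat_assoc)
    also have "\<dots> = 0\<^sub>m m m" by (simp add: PQ mat_simps mat_mult_eq_left[OF DX])
    finally show "(C * F + D * B) * (Y * X) = 0\<^sub>m m m"
      by (simp add: mat_simps mat_mult_eq_left[OF FY])
  qed auto
  ultimately show ?thesis unfolding ess_decomp_def by simp
qed

section \<open>Existence of a singular value decomposition\<close>

lemma one_by_one_mat: "M \<in> carrier_mat 1 1 \<Longrightarrow> M = M $$ (0, 0) \<cdot>\<^sub>m 1\<^sub>m 1"
  for M :: "'a :: semiring_1 mat"
  by (rule eq_matI) auto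

lemma smult_one_mat [simp]: "1 \<cdot>\<^sub>m A = (A :: 'a :: monoid_mult mat)"
  by (rule eq_matI) auto

section \<open>Unitary matrices and reflections\<close>

lemma unitary_mult:
  assumes "U \<in> carrier_mat n n" "V \<in> carrier_mat n n" "unitary_dual U" "unitary_dual V"
  shows "unitary_dual (U * V)"
  by (rule unitary_dualI[of _ n])
     (use assms in \<open>simp_all add: adj_mult mat_assoc unitary_dualD(2-)[OF assms(3)]
       unitary_dualD(2-)[OF assms(4)]\<close>)

lemma unitary_std_mat: "unitary_dual U \<Longrightarrow> unitary_dual (std_mat U)"
  by (auto simp: unitary_dual_def simp flip: std_mat_adj std_mat_mult)

lemma unitary_one: "unitary_dual (1\<^sub>m n)"
  by (auto simp: unitary_dual_def)

text \<open>With \<open>w = x - y\<close>, the map \<open>1 - w w\<^sup>H / (w\<^sup>H x)\<close> is a unitary that sends \<open>x\<close> to \<open>y\<close>.\<close>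

lemma householder:
  assumes x: "x \<in> carrier_mat n 1" "x\<^sup>H * x = 1\<^sub>m 1"
    and y: "y \<in> carrier_mat n 1" "y\<^sup>H * y = 1\<^sub>m 1"
    and ne: "std_part ((y\<^sup>H * x) $$ (0, 0)) \<noteq> 1"
  shows "\<exists>U. U \<in> carrier_mat n n \<and> unitary_dual U \<and> U * x = y"
proof -
  note [simp] = carrier_matD[OF x(1)] carrier_matD[OF y(1)]
  define c t k w W where "c = (y\<^sup>H * x) $$ (0, 0)" "t = 1 - c" "k = dual_inv t" "w = x - y" "W = w * w\<^sup>H"
  note defs = c_t_k_w_W_def
  have [simp]: "dim_row w = n" "dim_col w = 1" "dim_row W = n" "dim_col W = n"
    by (auto simp: defs)
  have kt: "k * t = 1" "conjugate k * conjugate t = 1"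
    using ne dual_inv(2)[of t] by (auto simp: defs simp flip: conjugate_dist_mul)
  have yx: "y\<^sup>H * x = c \<cdot>\<^sub>m 1\<^sub>m 1"
    unfolding defs by (rule one_by_one_mat) auto
  have xy: "x\<^sup>H * y = conjugate c \<cdot>\<^sub>m 1\<^sub>m 1"
    using arg_cong[OF yx, of adj] by (simp add: adj_simps)
  have wx: "w\<^sup>H * x = t \<cdot>\<^sub>m 1\<^sub>m 1"
    unfolding defs(4) by (rule eq_matI) (auto simp: adj_minus mat_simps x yx defs(2) simp del: index_mult_mat(1))
  have ww: "w\<^sup>H * w = (t + conjugate t) \<cdot>\<^sub>m 1\<^sub>m 1"
    unfolding defs(4)
    by (rule eq_matI) (auto simp: adj_minus mat_simps x y yx xy defs(2) conjugate_dual_minus simp del: index_mult_mat(1))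
  have WW: "W * W = (t + conjugate t) \<cdot>\<^sub>m W"
    unfolding defs(5) by (simp add: mat_simps mat_mult_eq_left[OF ww])
  have WH: "W\<^sup>H = W" by (simp add: defs(5) adj_mult)
  define U where "U = 1\<^sub>m n - k \<cdot>\<^sub>m W"
  have UH: "U\<^sup>H = 1\<^sub>m n - conjugate k \<cdot>\<^sub>m W"
    by (simp add: U_def adj_simps WH)
  \<comment> \<open>This is \<open>k * conjugate k * (t + conjugate t) = k + conjugate k\<close>, a
    consequence of \<open>k * t = 1\<close>, in the distributed form in which it appears entrywise.
    It cancels the terms in \<open>W\<close> of both unitarity equations, where \<open>W * W\<close>
    contributes \<open>t + conjugate t\<close>.\<close>
  have k2: "k * (t * (conjugate k * z)) + k * (conjugate k * (conjugate t * z)) = k * z + conjugate k * z" for z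
  proof -
    have "k * (t * (conjugate k * z)) + k * (conjugate k * (conjugate t * z))
        = (k * t) * (conjugate k * z) + k * ((conjugate k * conjugate t) * z)"
      by (simp only: mult.assoc)
    then show ?thesis by (simp add: kt)
  qed
  have "U\<^sup>H * U = 1\<^sub>m n" "U * U\<^sup>H = 1\<^sub>m n"
    unfolding UH unfolding U_def
    by (rule eq_matI; simp add: mat_simps WW k2 algebra_simps del: index_mult_mat(1))+
  moreover have "U * x = y"
  proof -
    have "W * x = t \<cdot>\<^sub>m w" by (simp add: defs(5) mat_simps wx)
    then have "U * x = x - w" by (simp add: U_def mat_simps kt)
    also have "\<dots> = y" by (rule eq_matI) (auto simp: defs(4))
    finally show ?thesis .
  qed
  moreover have "U \<in> carrier_mat n n" by (auto simp: U_def)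
  ultimately show ?thesis using unitary_dualI by blast
qed

definition unit_col :: "nat \<Rightarrow> nat \<Rightarrow> dual_complex mat" where
  "unit_col n k = mat n 1 (\<lambda>(i, j). if i = k then 1 else 0)"

lemma dim_unit_col [simp]: "dim_row (unit_col n k) = n" "dim_col (unit_col n k) = 1"
  by (auto simp: unit_col_def)

lemma index_unit_col [simp]: "i < n \<Longrightarrow> unit_col n k $$ (i, 0) = (if i = k then 1 else 0)"
  by (auto simp: unit_col_def)

lemma mult_unit_col:
  assumes "dim_col A = n" "i < dim_row A" "k < n"
  shows "(A * unit_col n k) $$ (i, 0) = A $$ (i, k)"
  using assms by (simp add: scalar_prod_def if_distrib[of "\<lambda>x. _ * x"] cong: if_cong)

lemma unit_col_unit:
  assumes "k < n"
  shows "(unit_col n k)\<^sup>H * unit_col n k = 1\<^sub>m 1"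
proof (rule eq_matI)
  fix i j assume "i < dim_row (1\<^sub>m 1 :: dual_complex mat)" "j < dim_col (1\<^sub>m 1 :: dual_complex mat)"
  then show "((unit_col n k)\<^sup>H * unit_col n k) $$ (i, j) = 1\<^sub>m 1 $$ (i, j)"
    using assms mult_unit_col[of "(unit_col n k)\<^sup>H" n 0 k] by simp
qed auto

text \<open>The reflection from the unit column to \<open>x\<close> divides by a number that is not
  invertible when the first entry of \<open>x\<close> has standard part 1. In that case a detour
  through the negated unit column works, as both inner products then have standard part -1.\<close>

lemma unitary_extension:
  assumes "0 < n" "x \<in> carrier_mat n 1" "x\<^sup>H * x = 1\<^sub>m 1"
  shows "\<exists>U. U \<in> carrier_mat n n \<and> unitary_dual U \<and> U * unit_col n 0 = x"
proof (cases "std_part (x $$ (0, 0)) = 1")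
  let ?e = "unit_col n 0"
  have e: "?e \<in> carrier_mat n 1" by auto
  have ex: "(x\<^sup>H * ?e) $$ (0, 0) = conjugate (x $$ (0, 0))"
    using assms by (subst mult_unit_col) auto
  case False
  then obtain U where "U \<in> carrier_mat n n" "unitary_dual U" "U * ?e = x"
    using householder[OF e unit_col_unit assms(2,3)] assms(1) by (auto simp del: index_mult_mat(1) simp: ex)
  then show ?thesis by blast
next
  let ?e = "unit_col n 0" and ?f = "(- 1) \<cdot>\<^sub>m unit_col n 0"
  have e: "?e \<in> carrier_mat n 1" "?f \<in> carrier_mat n 1" by auto
  have ex: "(x\<^sup>H * ?f) $$ (0, 0) = - conjugate (x $$ (0, 0))"
    using assms mult_unit_col[of "x\<^sup>H" n 0 0] by (simp add: mat_simps del: index_mult_mat(1))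
  have fe: "(?f\<^sup>H * ?e) $$ (0, 0) = - 1"
    using assms by (subst mult_unit_col) (auto simp: conjugate_neg)
  have f: "?f\<^sup>H * ?f = 1\<^sub>m 1"
    using assms by (simp add: adj_smult mat_simps conjugate_neg unit_col_unit)
  case True
  obtain U where U: "U \<in> carrier_mat n n" "unitary_dual U" "U * ?f = x"
    using householder[OF e(2) f assms(2,3)] True by (auto simp del: index_mult_mat(1) simp: ex)
  obtain V where V: "V \<in> carrier_mat n n" "unitary_dual V" "V * ?e = ?f"
    using householder[OF e(1) unit_col_unit e(2) f] assms(1) by (auto simp del: index_mult_mat(1) simp: fe)
  have "U * V * ?e = x"
    using U V by (simp add: mat_assoc)
  then show ?thesis using U V unitary_mult[OF U(1) V(1)] by (metis mult_carrier_mat)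
qed

section \<open>Splitting off one diagonal entry\<close>

abbreviation bdiag :: "dual_complex \<Rightarrow> dual_complex mat \<Rightarrow> dual_complex mat" where
  "bdiag \<sigma> A \<equiv> four_block_mat (\<sigma> \<cdot>\<^sub>m 1\<^sub>m 1) (0\<^sub>m 1 (dim_col A)) (0\<^sub>m (dim_row A) 1) A"

lemma bdiag_mult: "dim_col A = dim_row B \<Longrightarrow> bdiag \<sigma> A * bdiag \<tau> B = bdiag (\<sigma> * \<tau>) (A * B)"
  by (subst mult_four_block_mat[of _ 1 1 _ "dim_col A" _ "dim_row A" _ _ 1 _ "dim_col B"])
     (auto simp: mat_simps)

lemma bdiag_adj: "(bdiag \<sigma> A)\<^sup>H = bdiag (conjugate \<sigma>) (A\<^sup>H)"
  by (subst adj_four_block_mat[of _ 1 1 _ "dim_col A" _ "dim_row A"]) (auto simp: adj_smult)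

lemma bdiag_one: "bdiag 1 (1\<^sub>m n) = 1\<^sub>m (Suc n)"
  by (rule eq_matI) auto

lemma bdiag_dg: "bdiag \<sigma> (dg m n f) = dg (Suc m) (Suc n) (case_nat \<sigma> f)"
  by (rule eq_matI) (auto simp: dg_def split: nat.splits)

lemma unitary_bdiag:
  assumes "U \<in> carrier_mat n n" "unitary_dual U"
  shows "unitary_dual (bdiag 1 U)"
proof (rule unitary_dualI[of _ "Suc n"])
  have "(bdiag 1 U)\<^sup>H * bdiag 1 U = bdiag 1 (U\<^sup>H * U)" "bdiag 1 U * (bdiag 1 U)\<^sup>H = bdiag 1 (U * U\<^sup>H)"
    unfolding bdiag_adj by (subst bdiag_mult; simp)+
  then show "(bdiag 1 U)\<^sup>H * bdiag 1 U = 1\<^sub>m (Suc n)" "bdiag 1 U * (bdiag 1 U)\<^sup>H = 1\<^sub>m (Suc n)"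
    unfolding unitary_dualD(2,3)[OF assms(2)] using assms by (simp_all only: bdiag_one carrier_matD)
qed (use assms in auto)

text \<open>\<open>AV\<close> determines the first column of the transformed matrix, and
  \<open>AU\<close>, read through the adjoint, its first row. The case \<open>U = V\<close> serves
  the spectral theorem, the general one the SVD.\<close>

lemma peel_block:
  assumes A: "A \<in> carrier_mat (Suc m) (Suc n)"
    and U: "U \<in> carrier_mat (Suc m) (Suc m)" "unitary_dual U"
    and V: "V \<in> carrier_mat (Suc n) (Suc n)" "unitary_dual V"
    and AV: "A * (V * unit_col (Suc n) 0) = \<sigma> \<cdot>\<^sub>m (U * unit_col (Suc m) 0)"
    and AU: "A\<^sup>H * (U * unit_col (Suc m) 0) = conjugate \<sigma> \<cdot>\<^sub>m (V * unit_col (Suc n) 0)"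
  shows "\<exists>A' \<in> carrier_mat m n. U\<^sup>H * A * V = bdiag \<sigma> A'"
proof -
  note [simp] = carrier_matD[OF A] carrier_matD[OF U(1)] carrier_matD[OF V(1)]
  define F where "F = U\<^sup>H * A * V"
  have [simp]: "dim_row F = Suc m" "dim_col F = Suc n" by (auto simp: F_def)
  have 1: "F * unit_col (Suc n) 0 = \<sigma> \<cdot>\<^sub>m unit_col (Suc m) 0"
    by (simp add: F_def mat_simps AV unitary_dualD(2-)[OF U(2)])
  have 2: "F\<^sup>H * unit_col (Suc m) 0 = conjugate \<sigma> \<cdot>\<^sub>m unit_col (Suc n) 0"
    by (simp add: F_def adj_mult mat_simps AU unitary_dualD(2-)[OF V(2)])
  have F0: "F $$ (i, 0) = (if i = 0 then \<sigma> else 0)" if "i < Suc m" for i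
    using mult_unit_col[of F "Suc n" i 0] that unfolding 1 by (cases "i = 0") simp_all
  have "conjugate (F $$ (0, j)) = conjugate (if j = 0 then \<sigma> else 0)" if "j < Suc n" for j
    using mult_unit_col[of "F\<^sup>H" "Suc m" j 0] that unfolding 2 by (cases "j = 0") simp_all
  then have F1: "F $$ (0, j) = (if j = 0 then \<sigma> else 0)" if "j < Suc n" for j
    using that by (metis conjugate_cancel_iff)
  define A' where "A' = mat m n (\<lambda>(i, j). F $$ (Suc i, Suc j))"
  have "F = bdiag \<sigma> A'"
    using F0 F1 by (intro eq_matI) (auto simp: A'_def)
  then show ?thesis unfolding F_def by (intro bexI[of _ A']) (auto simp: A'_def)
qed

lemma peel_compose:
  assumes A: "A \<in> carrier_mat (Suc m) (Suc n)"
    and U: "U \<in> carrier_mat (Suc m) (Suc m)" "unitary_dual U"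
    and V: "V \<in> carrier_mat (Suc n) (Suc n)" "unitary_dual V"
    and F: "U\<^sup>H * A * V = bdiag \<sigma> (U' * dg m n f * V'\<^sup>H)"
    and U': "U' \<in> carrier_mat m m" and V': "V' \<in> carrier_mat n n"
  shows "A = (U * bdiag 1 U') * dg (Suc m) (Suc n) (case_nat \<sigma> f) * (V * bdiag 1 V')\<^sup>H"
proof -
  note [simp] = carrier_matD[OF A] carrier_matD[OF U(1)] carrier_matD[OF V(1)]
    carrier_matD[OF U'] carrier_matD[OF V']
  have "A = U * (U\<^sup>H * A * V) * V\<^sup>H"
    by (simp add: mat_simps unitary_dualD(2-)[OF U(2)] unitary_dualD(2-)[OF V(2)])
  also have "U\<^sup>H * A * V = bdiag 1 U' * bdiag \<sigma> (dg m n f) * (bdiag 1 V')\<^sup>H"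
    unfolding F bdiag_adj by (subst bdiag_mult, simp, subst bdiag_mult, simp, simp)
  finally show ?thesis
    unfolding bdiag_dg by (simp add: adj_mult mat_assoc)
qed

section \<open>Hermitian matrices with complex entries\<close>

lemma complex_unit_eigenvector:
  assumes M: "M \<in> carrier_mat n n" "std_mat M = M" and n: "0 < n"
  shows "\<exists>x l. x \<in> carrier_mat n 1 \<and> x\<^sup>H * x = 1\<^sub>m 1 \<and> std_mat x = x \<and> M * x = Dual l 0 \<cdot>\<^sub>m x"
proof -
  define N where "N = map_mat std_part M"
  have N: "N \<in> carrier_mat n n" using M by (auto simp: N_def)
  obtain l v where v: "v \<in> carrier_vec n" "v \<noteq> 0\<^sub>v n" "N *\<^sub>v v = l \<cdot>\<^sub>v v"
    using spectrum_non_empty[OF N n] N by (auto simp: spectrum_def eigenvalue_def eigenvector_def)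
  define s where "s = (\<Sum>i<n. (cmod (v $ i))\<^sup>2)"
  obtain k where k: "k < n" "v $ k \<noteq> 0"
    using v(1,2) by (metis carrier_vecD eq_vecI index_zero_vec)
  have "0 < (cmod (v $ k))\<^sup>2" using k by simp
  also have "\<dots> \<le> s" unfolding s_def using k by (intro member_le_sum) auto
  finally have s: "0 < s" .
  \<comment> \<open>Scaling by the reciprocal of the Euclidean norm of \<open>v\<close> gives a unit
    column.\<close>
  define c where "c = complex_of_real (1 / sqrt s)"
  define x where "x = mat n 1 (\<lambda>(i, j). Dual (c * v $ i) 0)"
  have xi: "x $$ (i, 0) = Dual (c * v $ i) 0" if "i < n" for i
    using that by (simp add: x_def)
  have x: "x \<in> carrier_mat n 1" by (simp add: x_def)
  have c2: "cnj c * c = complex_of_real (1 / s)"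
    using s by (simp add: c_def flip: of_real_mult)
  have "(\<Sum>i<n. cnj (c * v $ i) * (c * v $ i)) = (\<Sum>i<n. (cnj c * c) * complex_of_real ((cmod (v $ i))\<^sup>2))"
    by (intro sum.cong) (simp_all add: complex_norm_square[symmetric] mult_ac)
  also have "\<dots> = cnj c * c * complex_of_real s"
    unfolding s_def of_real_sum sum_distrib_left ..
  also have "\<dots> = 1"
    using s unfolding c2 by (simp flip: of_real_mult)
  finally have sum: "(\<Sum>i<n. cnj (c * v $ i) * (c * v $ i)) = 1" .
  have "x\<^sup>H * x = 1\<^sub>m 1"
    using x sum by (intro eq_matI) (auto simp: scalar_prod_def xi dual_eq_iff atLeast0LessThan)
  moreover have "std_mat x = x"
    using x by (intro eq_matI) (auto simp: xi)
  moreover have "M * x = Dual l 0 \<cdot>\<^sub>m x"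
  proof (rule eq_matI)
    fix i j assume "i < dim_row (Dual l 0 \<cdot>\<^sub>m x)" "j < dim_col (Dual l 0 \<cdot>\<^sub>m x)"
    then have i: "i < n" and j: "j = 0" using x by auto
    have M0: "inf_part (M $$ (i, k)) = 0" if "k < n" for k
      using M(1) i that by (subst M(2)[symmetric]) simp
    have "(N *\<^sub>v v) $ i = l * v $ i" using v i by simp
    then have Nv: "(\<Sum>k<n. std_part (M $$ (i, k)) * v $ k) = l * v $ i"
      using M(1) v(1) i by (simp add: N_def scalar_prod_def atLeast0LessThan)
    then have "(\<Sum>k<n. std_part (M $$ (i, k)) * (c * v $ k)) = c * (l * v $ i)"
      by (simp add: sum_distrib_left mult.left_commute flip: Nv)
    then show "(M * x) $$ (i, j) = (Dual l 0 \<cdot>\<^sub>m x) $$ (i, j)"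
      using M(1) x i unfolding j by (simp add: scalar_prod_def xi dual_eq_iff M0 atLeast0LessThan mult_ac)
  qed (use M x in auto)
  ultimately show ?thesis using x by blast
qed

text \<open>The Rayleigh quotient \<open>x\<^sup>H * M * x\<close> equals its own adjoint, and at a
  unit eigenvector it is \<open>a\<close>.\<close>

lemma hermitian_eigenvalue_self_conjugate:
  assumes M: "M \<in> carrier_mat n n" "M\<^sup>H = M"
    and x: "x \<in> carrier_mat n 1" "x\<^sup>H * x = 1\<^sub>m 1" "M * x = a \<cdot>\<^sub>m x"
  shows "conjugate a = a"
proof -
  note [simp] = carrier_matD[OF M(1)] carrier_matD[OF x(1)]
  have xMx: "x\<^sup>H * (M * x) = a \<cdot>\<^sub>m 1\<^sub>m 1"
    by (simp add: x mat_mult_smult)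
  have "x\<^sup>H * (M * x) = conjugate a \<cdot>\<^sub>m 1\<^sub>m 1"
    using arg_cong[OF xMx, of adj] by (simp add: adj_simps M mat_assoc)
  with xMx have "conjugate a \<cdot>\<^sub>m 1\<^sub>m 1 = a \<cdot>\<^sub>m (1\<^sub>m 1 :: dual_complex mat)" by simp
  then have "(conjugate a \<cdot>\<^sub>m 1\<^sub>m 1 :: dual_complex mat) $$ (0, 0) = (a \<cdot>\<^sub>m 1\<^sub>m 1) $$ (0, 0)" by simp
  then show ?thesis by simp
qed

lemma conjugate_self_iff: "conjugate a = a \<longleftrightarrow> dual_number a"
  by (simp add: dual_eq_iff dual_number_def Reals_cnj_iff)

lemma hermitian_spectral:
  assumes "M \<in> carrier_mat n n" "M\<^sup>H = M" "std_mat M = M"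
  shows "\<exists>W d. W \<in> carrier_mat n n \<and> unitary_dual W \<and> std_mat W = W \<and>
    M = W * dg n n (\<lambda>i. Dual (complex_of_real (d i)) 0) * W\<^sup>H"
  using assms
proof (induction n arbitrary: M)
  case 0
  then show ?case
    by (intro exI[of _ "1\<^sub>m 0"] exI[of _ "\<lambda>_. 0"]) (auto simp: unitary_one)
next
  case (Suc n)
  note [simp] = carrier_matD[OF Suc.prems(1)]
  obtain x l where x: "x \<in> carrier_mat (Suc n) 1" "x\<^sup>H * x = 1\<^sub>m 1" "std_mat x = x"
    "M * x = Dual l 0 \<cdot>\<^sub>m x"
    using complex_unit_eigenvector[OF Suc.prems(1,3)] by blast
  have conj: "conjugate (Dual l 0) = Dual l 0"
    using hermitian_eigenvalue_self_conjugate[OF Suc.prems(1,2) x(1,2,4)] .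
  then obtain a where a: "l = complex_of_real a"
    by (auto simp: conjugate_self_iff dual_number_def elim: Reals_cases)
  obtain U0 where U0: "U0 \<in> carrier_mat (Suc n) (Suc n)" "unitary_dual U0" "U0 * unit_col (Suc n) 0 = x"
    using unitary_extension[OF _ x(1,2)] by blast
  \<comment> \<open>\<open>U0\<close> may have infinitesimal parts. Its standard part is still
    unitary and still maps the unit column to \<open>x\<close>, since \<open>x\<close> has complex
    entries; so the induction stays within complex matrices.\<close>
  define U where "U = std_mat U0"
  have std_e: "std_mat (unit_col (Suc n) 0) = unit_col (Suc n) 0"
    by (rule eq_matI) (auto simp: dual_eq_iff)
  have U: "U \<in> carrier_mat (Suc n) (Suc n)" "unitary_dual U" "U * unit_col (Suc n) 0 = x" "std_mat U = U"
    using U0 x(3) unitary_std_mat[OF U0(2)] std_mat_mult[of U0 "unit_col (Suc n) 0"]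
    by (auto simp: U_def std_e)
  obtain M' where M': "M' \<in> carrier_mat n n" "U\<^sup>H * M * U = bdiag (Dual l 0) M'"
    using peel_block[OF Suc.prems(1) U(1,2) U(1,2), of "Dual l 0"] x conj Suc.prems(2) U(3) by auto
  note [simp] = carrier_matD[OF M'(1)] carrier_matD[OF U(1)]
  have M'_eq: "M' = mat n n (\<lambda>(i, j). (U\<^sup>H * M * U) $$ (Suc i, Suc j))"
    unfolding M'(2) by (rule eq_matI) auto
  have h: "(U\<^sup>H * M * U)\<^sup>H = U\<^sup>H * M * U" "std_mat (U\<^sup>H * M * U) = U\<^sup>H * M * U"
    using Suc.prems U by (simp_all add: adj_mult std_simps mat_assoc)
  have "M'\<^sup>H = M'"
  proof (rule eq_matI)
    fix i j assume "i < dim_row M'" "j < dim_col M'"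
    then show "M'\<^sup>H $$ (i, j) = M' $$ (i, j)"
      using arg_cong[OF h(1), of "\<lambda>X. X $$ (Suc i, Suc j)"] by (simp add: M'_eq del: index_mult_mat(1))
  qed auto
  moreover have "std_mat M' = M'"
  proof (rule eq_matI)
    fix i j assume "i < dim_row M'" "j < dim_col M'"
    then show "std_mat M' $$ (i, j) = M' $$ (i, j)"
      using arg_cong[OF h(2), of "\<lambda>X. X $$ (Suc i, Suc j)"] by (simp add: M'_eq del: index_mult_mat(1))
  qed auto
  ultimately obtain W d where W: "W \<in> carrier_mat n n" "unitary_dual W" "std_mat W = W"
    "M' = W * dg n n (\<lambda>i. Dual (complex_of_real (d i)) 0) * W\<^sup>H"
    using Suc.IH[OF M'(1)] by blast
  note [simp] = carrier_matD[OF W(1)]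
  have "M = (U * bdiag 1 W) * dg (Suc n) (Suc n) (case_nat (Dual l 0) (\<lambda>i. Dual (complex_of_real (d i)) 0)) * (U * bdiag 1 W)\<^sup>H"
    using peel_compose[OF Suc.prems(1) U(1,2) U(1,2) M'(2)[unfolded W(4)] W(1,1)] .
  moreover have "case_nat (Dual l 0) (\<lambda>i. Dual (complex_of_real (d i)) 0) = (\<lambda>i. Dual (complex_of_real (case_nat a d i)) 0)"
    by (auto simp: a fun_eq_iff split: nat.splits)
  moreover have bW: "bdiag 1 W \<in> carrier_mat (Suc n) (Suc n)"
    by (rule carrier_matI) auto
  then have "unitary_dual (U * bdiag 1 W)" "U * bdiag 1 W \<in> carrier_mat (Suc n) (Suc n)"
    using unitary_mult[OF U(1) bW U(2) unitary_bdiag[OF W(1,2)]] mult_carrier_mat[OF U(1) bW] by auto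
  moreover have "inf_part (W $$ (i, j)) = 0" if "i < n" "j < n" for i j
    using that by (subst W(3)[symmetric]) simp
  then have "std_mat (bdiag 1 W) = bdiag 1 W"
    by (intro eq_matI) (auto simp: dual_eq_iff)
  then have "std_mat (U * bdiag 1 W) = U * bdiag 1 W"
    using U by (simp add: std_simps)
  ultimately show ?case by metis
qed

lemma unit_col_eigenvector:
  assumes W: "W \<in> carrier_mat n n" "unitary_dual W" and k: "k < n"
  shows "W * dg n n f * W\<^sup>H * (W * unit_col n k) = f k \<cdot>\<^sub>m (W * unit_col n k)"
    "(W * unit_col n k)\<^sup>H * (W * unit_col n k) = 1\<^sub>m 1"
proof -
  note [simp] = carrier_matD[OF W(1)]
  have "dg n n f * unit_col n k = f k \<cdot>\<^sub>m unit_col n k"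
  proof (rule eq_matI)
    fix i j assume "i < dim_row (f k \<cdot>\<^sub>m unit_col n k)" "j < dim_col (f k \<cdot>\<^sub>m unit_col n k)"
    then show "(dg n n f * unit_col n k) $$ (i, j) = (f k \<cdot>\<^sub>m unit_col n k) $$ (i, j)"
      using mult_unit_col[of "dg n n f" n i k] k by (simp del: index_mult_mat(1))
  qed auto
  then show "W * dg n n f * W\<^sup>H * (W * unit_col n k) = f k \<cdot>\<^sub>m (W * unit_col n k)"
    by (simp add: mat_simps unitary_dualD(2-)[OF W(2)])
  show "(W * unit_col n k)\<^sup>H * (W * unit_col n k) = 1\<^sub>m 1"
    using unit_col_unit[OF k] by (simp add: adj_mult mat_simps unitary_dualD(2-)[OF W(2)])
qed

lemma hermitian_nonzero_eigenvalue:
  assumes "M \<in> carrier_mat n n" "M\<^sup>H = M" "std_mat M = M" "M \<noteq> 0\<^sub>m n n"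
  shows "\<exists>x a. x \<in> carrier_mat n 1 \<and> x\<^sup>H * x = 1\<^sub>m 1 \<and> a \<noteq> 0 \<and> M * x = Dual (complex_of_real a) 0 \<cdot>\<^sub>m x"
proof -
  obtain W d where W: "W \<in> carrier_mat n n" "unitary_dual W"
    "M = W * dg n n (\<lambda>i. Dual (complex_of_real (d i)) 0) * W\<^sup>H"
    using hermitian_spectral[OF assms(1-3)] by blast
  note [simp] = carrier_matD[OF W(1)]
  have "\<exists>k<n. d k \<noteq> 0"
  proof (rule ccontr)
    assume "\<not> (\<exists>k<n. d k \<noteq> 0)"
    then have "dg n n (\<lambda>i. Dual (complex_of_real (d i)) 0) = 0\<^sub>m n n"
      by (intro eq_matI) (auto simp: dual_eq_iff)
    then show False using assms(4) W(3) by (simp add: mat_simps)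
  qed
  then obtain k where "k < n" "d k \<noteq> 0" by blast
  then show ?thesis
    using unit_col_eigenvector(1)[OF W(1,2), of k "\<lambda>i. Dual (complex_of_real (d i)) 0"]
      unit_col_eigenvector(2)[OF W(1,2), of k] W(3)
    by (intro exI[of _ "W * unit_col n k"] exI[of _ "d k"]) auto
qed

text \<open>First-order perturbation theory: the eigenvalue \<open>l\<close> of the standard part splits along the
  eigenvalues of the infinitesimal part compressed to the eigenspace of \<open>l\<close>. Here \<open>P\<close> projects
  onto that eigenspace and \<open>G\<close> is the reduced resolvent.\<close>

lemma hermitian_dual_eigenvector:
  assumes M: "M \<in> carrier_mat n n" "M\<^sup>H = M" and nz: "std_mat M \<noteq> 0\<^sub>m n n"
  shows "\<exists>v l \<mu>. v \<in> carrier_mat n 1 \<and> v\<^sup>H * v = 1\<^sub>m 1 \<and> l \<noteq> 0 \<and>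
    M * v = Dual (complex_of_real l) (complex_of_real \<mu>) \<cdot>\<^sub>m v"
proof -
  define R where "R a = Dual (complex_of_real a) 0" for a
  define \<epsilon> where "\<epsilon> = Dual 0 1"
  have R: "R a * R b = R (a * b)" "R 1 = 1" "R 0 = 0" "conjugate (R a) = R a" for a b
    by (auto simp: R_def dual_eq_iff)
  have eps: "\<epsilon> * \<epsilon> = 0" "\<epsilon> * (\<epsilon> * a) = 0" "conjugate \<epsilon> = \<epsilon>" for a
    by (auto simp: \<epsilon>_def dual_eq_iff)
  define S N where "S = std_mat M" "N = inf_mat M"
  have MSN: "M = S + \<epsilon> \<cdot>\<^sub>m N"
    unfolding S_N_def \<epsilon>_def by (rule std_inf_decomp)
  have SN: "S \<in> carrier_mat n n" "N \<in> carrier_mat n n" "S\<^sup>H = S" "std_mat S = S" "N\<^sup>H = N" "std_mat N = N"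
    using M by (auto simp: S_N_def simp flip: std_mat_adj)
  obtain W d where W: "W \<in> carrier_mat n n" "unitary_dual W" "std_mat W = W"
    and S: "S = W * dg n n (\<lambda>i. R (d i)) * W\<^sup>H"
    using hermitian_spectral[OF SN(1,3,4)] unfolding R_def by blast
  note [simp] = carrier_matD[OF W(1)] carrier_matD[OF SN(1)] carrier_matD[OF SN(2)]
  \<comment> \<open>A nonzero eigenvalue is chosen because the dual square root taken later divides
    by \<open>sqrt l\<close>.\<close>
  have "\<exists>j<n. d j \<noteq> 0"
  proof (rule ccontr)
    assume "\<not> (\<exists>k<n. d k \<noteq> 0)"
    then have "dg n n (\<lambda>i. R (d i)) = 0\<^sub>m n n"
      by (intro eq_matI) (auto simp: R)
    then show False using nz S by (simp add: mat_simps S_N_def)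
  qed
  then obtain j where j: "j < n" "d j \<noteq> 0" by blast
  define l where "l = d j"
  \<comment> \<open>\<open>p\<close> marks the positions of the eigenvalue \<open>l\<close>;
    \<open>g\<close> inverts \<open>d i - l\<close> elsewhere and is 0 at the marked positions,
    whence \<open>(S - l) G = 1 - P\<close>.\<close>
  define p g where "p = (\<lambda>i. R (if d i = l then 1 else 0))"
    "g = (\<lambda>i. R (if d i = l then 0 else 1 / (d i - l)))"
  define P G where "P = W * dg n n p * W\<^sup>H" "G = W * dg n n g * W\<^sup>H"
  note PG = P_G_def p_g_def
  have [simp]: "dim_row P = n" "dim_col P = n" "dim_row G = n" "dim_col G = n" by (auto simp: PG)
  have calc: "W * dg n n f * W\<^sup>H * (W * dg n n h * W\<^sup>H) = W * dg n n (\<lambda>i. f i * h i) * W\<^sup>H" for f h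
  proof -
    have "dg n n f * dg n n h = dg n n (\<lambda>i. f i * h i)"
      unfolding dg_mult by (rule eq_matI) auto
    from mat_mult_eq_left[OF this, of "W\<^sup>H"] show ?thesis
      by (simp add: mat_assoc unitary_dualD(2-)[OF W(2)])
  qed
  have herm: "P\<^sup>H = P" "G\<^sup>H = G"
    by (simp_all add: PG adj_mult adj_dg R mat_assoc)
  have dgs: "dg n n (\<lambda>i. R (d i) * p i) = R l \<cdot>\<^sub>m dg n n p" "dg n n (\<lambda>i. p i * g i) = 0\<^sub>m n n"
    "dg n n (\<lambda>i. p i * p i) = dg n n p"
    "dg n n (\<lambda>i. R (d i) * g i) = R l \<cdot>\<^sub>m dg n n g + (1\<^sub>m n - dg n n p)"
    by (rule eq_matI; auto simp: p_g_def R; auto simp: R_def dual_eq_iff field_simps)+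
  have SP: "S * P = R l \<cdot>\<^sub>m P"
    unfolding P_G_def S calc dgs by (simp add: mat_simps)
  have PP: "P * P = P"
    unfolding P_G_def calc dgs ..
  have PG0: "P * G = 0\<^sub>m n n"
    unfolding P_G_def calc dgs by (simp add: mat_simps)
  have SG: "S * G = R l \<cdot>\<^sub>m G + (1\<^sub>m n - P)"
    unfolding P_G_def S calc dgs by (simp add: mat_simps unitary_dualD(2-)[OF W(2)])
  have GP0: "G * P = 0\<^sub>m n n"
    using arg_cong[OF PG0, of adj] by (simp add: adj_mult herm)
  define K where "K = P * N * P"
  have "\<exists>x \<mu>. x \<in> carrier_mat n 1 \<and> x\<^sup>H * x = 1\<^sub>m 1 \<and> P * x = x \<and> K * x = R \<mu> \<cdot>\<^sub>m x"
  \<comment> \<open>An eigenvector of \<open>K\<close> for a nonzero eigenvalue lies in the range of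
    \<open>P\<close>, but one for the eigenvalue 0 need not. If \<open>K\<close> vanishes, any unit
    vector in that range will do, here the column of \<open>W\<close> at \<open>j\<close>.\<close>
  proof (cases "K = 0\<^sub>m n n")
    case True
    let ?x = "W * unit_col n j"
    have "P * ?x = ?x"
      using unit_col_eigenvector(1)[OF W(1,2) j(1), of p] by (simp add: P_G_def) (simp add: p_g_def l_def R)
    moreover have "K * ?x = R 0 \<cdot>\<^sub>m ?x"
      unfolding True R by (rule eq_matI) (auto simp: mat_simps)
    moreover have "?x \<in> carrier_mat n 1" by auto
    ultimately show ?thesis
      using unit_col_eigenvector(2)[OF W(1,2) j(1)] by blast
  next
    case False
    have "std_mat (dg n n p) = dg n n p"
      by (rule eq_matI) (auto simp: p_g_def R_def dual_eq_iff)
    then have "std_mat P = P"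
      by (simp add: P_G_def std_simps W)
    then have "K \<in> carrier_mat n n" "K\<^sup>H = K" "std_mat K = K"
      by (auto simp: K_def adj_mult herm SN std_simps mat_assoc)
    from hermitian_nonzero_eigenvalue[OF this False] obtain x a where
      x: "x \<in> carrier_mat n 1" "x\<^sup>H * x = 1\<^sub>m 1" "a \<noteq> 0" "K * x = R a \<cdot>\<^sub>m x"
      unfolding R_def by blast
    note [simp] = carrier_matD[OF x(1)]
    have [simp]: "dim_row K = n" "dim_col K = n" by (auto simp: K_def)
    have "P * K = K" by (simp add: K_def mat_assoc mat_mult_eq_left[OF PP])
    then have "P * (K * x) = K * x" by (simp flip: mat_assoc)
    then have "R (1 / a) \<cdot>\<^sub>m (R a \<cdot>\<^sub>m (P * x)) = R (1 / a) \<cdot>\<^sub>m (R a \<cdot>\<^sub>m x)"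
      unfolding x(4) by (simp add: mat_mult_smult)
    then have "P * x = x" using x(3) by (simp add: mat_smult_smult R)
    then show ?thesis using x by blast
  qed
  then obtain x \<mu> where x: "x \<in> carrier_mat n 1" "x\<^sup>H * x = 1\<^sub>m 1" "P * x = x" "K * x = R \<mu> \<cdot>\<^sub>m x" by blast
  note [simp] = carrier_matD[OF x(1)]
  have Sx: "S * x = R l \<cdot>\<^sub>m x"
    using mat_mult_eq_left[OF SP, of x] by (simp add: x mat_simps)
  have PNx: "P * (N * x) = R \<mu> \<cdot>\<^sub>m x"
    using x(4) by (simp add: K_def mat_assoc x(3))
  have Gx: "G * x = 0\<^sub>m n 1"
    using mat_mult_eq_left[OF GP0, of x] by (simp add: x mat_simps)
  have xG: "x\<^sup>H * G = 0\<^sub>m 1 n"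
    using arg_cong[OF Gx, of adj] by (simp add: adj_mult herm)
  \<comment> \<open>For \<open>v = x + \<epsilon> u\<close> the infinitesimal part of the eigenvalue
    equation is \<open>(S - l) u = (\<mu> - N) x\<close>. It is solved by
    \<open>u = - G N x\<close>, because \<open>(S - l) G = 1 - P\<close> and
    \<open>P N x = \<mu> x\<close>. The norm stays 1 because \<open>x\<^sup>H G = 0\<close>.\<close>
  define v where "v = x - \<epsilon> \<cdot>\<^sub>m (G * (N * x))"
  have v: "v \<in> carrier_mat n 1" by (auto simp: v_def)
  have zero: "0 \<cdot>\<^sub>m A = 0\<^sub>m (dim_row A) (dim_col A)" for A :: "dual_complex mat"
    by (rule eq_matI) auto
  have "v\<^sup>H * v = 1\<^sub>m 1"
    unfolding v_def
    by (rule eq_matI) (simp_all add: adj_simps herm SN mat_simps eps x zero mat_mult_eq_left[OF xG] Gx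
        del: index_mult_mat(1))
  moreover have "M * v = Dual (complex_of_real l) (complex_of_real \<mu>) \<cdot>\<^sub>m v"
  proof -
    have lm: "Dual (complex_of_real l) (complex_of_real \<mu>) = R l + \<epsilon> * R \<mu>"
      by (auto simp: R_def \<epsilon>_def dual_eq_iff)
    have ring: "L * a + \<epsilon> * b - \<epsilon> * (L * c + (b - m * a) + \<epsilon> * d) = (L + \<epsilon> * m) * (a - \<epsilon> * c)"
      for L m a b c d
      by (simp add: \<epsilon>_def dual_eq_iff algebra_simps)
    have "M * v = R l \<cdot>\<^sub>m x + \<epsilon> \<cdot>\<^sub>m (N * x) - \<epsilon> \<cdot>\<^sub>m
      (R l \<cdot>\<^sub>m (G * (N * x)) + (N * x - R \<mu> \<cdot>\<^sub>m x) + \<epsilon> \<cdot>\<^sub>m (N * (G * (N * x))))"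
      unfolding MSN v_def by (simp add: mat_simps Sx mat_mult_eq_left[OF SG] PNx)
    also have "\<dots> = (R l + \<epsilon> * R \<mu>) \<cdot>\<^sub>m v"
      by (rule eq_matI) (simp_all add: v_def ring del: index_mult_mat(1))
    finally show ?thesis unfolding lm .
  qed
  moreover have "l \<noteq> 0" using j l_def by simp
  ultimately show ?thesis using v by blast
qed

section \<open>Singular pairs\<close>

lemma gram_diag_sum:
  assumes "j < dim_col A"
  shows "std_part ((A\<^sup>H * A) $$ (j, j)) = complex_of_real (\<Sum>i<dim_row A. (cmod (std_part (A $$ (i, j))))\<^sup>2)"
proof -
  have "cnj z * z = complex_of_real ((cmod z)\<^sup>2)" for z
    by (metis complex_norm_square mult.commute)
  then show ?thesis
    using assms by (simp add: scalar_prod_def atLeast0LessThan)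
qed

text \<open>\<open>y\<close> is a unit eigenvector of \<open>A\<^sup>H * A\<close>,
  \<open>\<sigma>\<close> the dual square root of its eigenvalue, and \<open>x\<close> is
  \<open>A * y\<close> divided by \<open>\<sigma>\<close>.\<close>

lemma singular_pair_appreciable:
  assumes A: "A \<in> carrier_mat m n" and nz: "\<not> infinitesimal A"
  shows "\<exists>x y \<sigma>. x \<in> carrier_mat m 1 \<and> x\<^sup>H * x = 1\<^sub>m 1 \<and> y \<in> carrier_mat n 1 \<and> y\<^sup>H * y = 1\<^sub>m 1 \<and>
    positive_appreciable \<sigma> \<and> A * y = \<sigma> \<cdot>\<^sub>m x \<and> A\<^sup>H * x = \<sigma> \<cdot>\<^sub>m y"
proof -
  note [simp] = carrier_matD[OF A]
  have nz': "std_mat (A\<^sup>H * A) \<noteq> 0\<^sub>m n n"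
  proof
    assume *: "std_mat (A\<^sup>H * A) = 0\<^sub>m n n"
    have "std_part (A $$ (i, j)) = 0" if "i < m" "j < n" for i j
    proof -
      have "Dual (std_part ((A\<^sup>H * A) $$ (j, j))) 0 = 0"
        using arg_cong[OF *, of "\<lambda>X. X $$ (j, j)"] that by (simp del: index_mult_mat(1))
      then have "(\<Sum>i<m. (cmod (std_part (A $$ (i, j))))\<^sup>2) = 0"
        using that gram_diag_sum[of j A] by (simp add: dual_eq_iff del: index_mult_mat(1) of_real_sum)
      then show ?thesis using that by (simp add: sum_nonneg_eq_0_iff)
    qed
    then show False using nz by (auto simp: infinitesimal_def)
  qed
  have "A\<^sup>H * A \<in> carrier_mat n n" "(A\<^sup>H * A)\<^sup>H = A\<^sup>H * A" by (auto simp: adj_mult)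
  from hermitian_dual_eigenvector[OF this nz'] obtain y l \<mu> where
    y: "y \<in> carrier_mat n 1" "y\<^sup>H * y = 1\<^sub>m 1" "l \<noteq> 0"
      "A\<^sup>H * A * y = Dual (complex_of_real l) (complex_of_real \<mu>) \<cdot>\<^sub>m y" by blast
  note [simp] = carrier_matD[OF y(1)]
  define a where "a = Dual (complex_of_real l) (complex_of_real \<mu>)"
  have AAy: "A\<^sup>H * (A * y) = a \<cdot>\<^sub>m y"
    using y(4) by (simp add: a_def mat_assoc)
  have gram: "(A * y)\<^sup>H * (A * y) = a \<cdot>\<^sub>m 1\<^sub>m 1"
    by (simp add: adj_mult mat_simps AAy y(2))
  \<comment> \<open>\<open>l\<close> is the squared norm of the standard part of
    \<open>A * y\<close>, hence not negative.\<close>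
  have "complex_of_real l = std_part (((A * y)\<^sup>H * (A * y)) $$ (0, 0))"
    unfolding gram by (simp add: a_def)
  also have "\<dots> = complex_of_real (\<Sum>i<m. (cmod (std_part ((A * y) $$ (i, 0))))\<^sup>2)"
    by (subst gram_diag_sum) auto
  finally have "l = (\<Sum>i<m. (cmod (std_part ((A * y) $$ (i, 0))))\<^sup>2)"
    by (simp only: of_real_eq_iff)
  then have "l \<ge> 0" by (simp add: sum_nonneg)
  with y(3) have l: "l > 0" by simp
  \<comment> \<open>The expansion of the square root of l + \<mu> eps to first order.\<close>
  define \<sigma> where "\<sigma> = Dual (complex_of_real (sqrt l)) (complex_of_real (\<mu> / (2 * sqrt l)))"
  have s0: "std_part \<sigma> \<noteq> 0" using l by (simp add: \<sigma>_def)
  have "complex_of_real (sqrt l) * complex_of_real (sqrt l) = complex_of_real l"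
    using l by (simp flip: of_real_mult)
  moreover have "sqrt l * (\<mu> / (2 * sqrt l)) + \<mu> / (2 * sqrt l) * sqrt l = \<mu>"
    using l by (simp add: field_simps)
  then have "complex_of_real (sqrt l) * complex_of_real (\<mu> / (2 * sqrt l))
      + complex_of_real (\<mu> / (2 * sqrt l)) * complex_of_real (sqrt l) = complex_of_real \<mu>"
    by (metis of_real_add of_real_mult)
  ultimately have \<sigma>2: "\<sigma> * \<sigma> = a"
    unfolding \<sigma>_def a_def dual_eq_iff by simp
  define k where "k = dual_inv \<sigma>"
  have k: "\<sigma> * k = 1" "k * \<sigma> = 1" using dual_inv[OF s0] by (auto simp: k_def)
  have cs: "conjugate \<sigma> = \<sigma>" by (auto simp: \<sigma>_def dual_eq_iff)
  then have ck: "conjugate k = k"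
    using k by (metis conjugate_dist_mul conjugate_dual_one mult.assoc mult.commute mult.right_neutral)
  have kka: "k * (k * a) = 1" "k * a = \<sigma>"
  proof -
    show "k * a = \<sigma>" unfolding \<sigma>2[symmetric] using k by (simp flip: mult.assoc)
    then show "k * (k * a) = 1" using k by simp
  qed
  define x where "x = k \<cdot>\<^sub>m (A * y)"
  have "x\<^sup>H * x = 1\<^sub>m 1"
    unfolding x_def by (simp add: adj_smult mat_simps ck gram kka k mult.assoc)
  moreover have "A * y = \<sigma> \<cdot>\<^sub>m x" by (simp add: x_def mat_smult_smult k)
  moreover have "A\<^sup>H * x = \<sigma> \<cdot>\<^sub>m y" by (simp add: x_def mat_simps AAy kka)
  moreover have "positive_appreciable \<sigma>"
    using l cs by (simp add: positive_appreciable_def flip: conjugate_self_iff) (simp add: \<sigma>_def)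
  moreover have "x \<in> carrier_mat m 1" by (auto simp: x_def)
  ultimately show ?thesis using y by blast
qed

text \<open>An infinitesimal \<open>A\<close> is eps times \<open>inf_mat A\<close>, so a singular
  pair of the latter serves, with \<open>\<sigma>\<close> multiplied by eps.\<close>

lemma singular_pair:
  assumes A: "A \<in> carrier_mat m n" and nz: "A \<noteq> 0\<^sub>m m n"
  shows "\<exists>x y \<sigma>. x \<in> carrier_mat m 1 \<and> x\<^sup>H * x = 1\<^sub>m 1 \<and> y \<in> carrier_mat n 1 \<and> y\<^sup>H * y = 1\<^sub>m 1 \<and>
    (if infinitesimal A then positive_infinitesimal \<sigma> else positive_appreciable \<sigma>) \<and>
    A * y = \<sigma> \<cdot>\<^sub>m x \<and> A\<^sup>H * x = \<sigma> \<cdot>\<^sub>m y"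
proof (cases "infinitesimal A")
  case False
  then show ?thesis using singular_pair_appreciable[OF A] by auto
next
  case True
  have Ae: "A = Dual 0 1 \<cdot>\<^sub>m inf_mat A"
    by (rule eq_matI) (use True A in \<open>auto simp: infinitesimal_def dual_eq_iff\<close>)
  have "\<not> infinitesimal (inf_mat A)"
  proof
    assume "infinitesimal (inf_mat A)"
    then have "A = 0\<^sub>m m n"
      using A True by (intro eq_matI) (auto simp: infinitesimal_def dual_eq_iff)
    with nz show False by simp
  qed
  moreover have "inf_mat A \<in> carrier_mat m n" using A by auto
  ultimately obtain x y \<sigma> where
    *: "x \<in> carrier_mat m 1" "x\<^sup>H * x = 1\<^sub>m 1" "y \<in> carrier_mat n 1" "y\<^sup>H * y = 1\<^sub>m 1"
    "positive_appreciable \<sigma>" "inf_mat A * y = \<sigma> \<cdot>\<^sub>m x" "(inf_mat A)\<^sup>H * x = \<sigma> \<cdot>\<^sub>m y"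
    using singular_pair_appreciable by blast
  have ce: "conjugate (Dual 0 1) = Dual 0 1" by (simp add: dual_eq_iff)
  have "A * y = (Dual 0 1 * \<sigma>) \<cdot>\<^sub>m x" "A\<^sup>H * x = (Dual 0 1 * \<sigma>) \<cdot>\<^sub>m y"
    by (subst Ae, use * A in \<open>simp add: adj_smult ce mat_simps\<close>)+
  moreover have "positive_infinitesimal (Dual 0 1 * \<sigma>)"
    using *(5) by (auto simp: positive_infinitesimal_def positive_appreciable_def dual_number_def)
  ultimately show ?thesis using * True by (intro exI[of _ x] exI[of _ y] exI[of _ "Dual 0 1 * \<sigma>"]) simp
qed

text \<open>Appreciable values come first because an infinitesimal one is split off only when the
  whole matrix is infinitesimal. The last conjunct carries this through the induction: from then on
  no appreciable value may follow.\<close>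

lemma dual_svd_diagonal:
  assumes "A \<in> carrier_mat m n"
  shows "\<exists>U V f r. U \<in> carrier_mat m m \<and> unitary_dual U \<and> V \<in> carrier_mat n n \<and> unitary_dual V \<and>
    A = U * dg m n f * V\<^sup>H \<and> r \<le> min m n \<and> (\<forall>i<r. positive_appreciable (f i)) \<and>
    (\<forall>i. r \<le> i \<longrightarrow> positive_infinitesimal (f i) \<or> f i = 0) \<and> (infinitesimal A \<longrightarrow> r = 0)"
  using assms
proof (induction m arbitrary: n A)
  case 0
  then have "A = 1\<^sub>m 0 * dg 0 n (\<lambda>_. 0) * (1\<^sub>m n)\<^sup>H"
    by (intro eq_matI) auto
  then show ?case
    using unitary_one by (intro exI[of _ "1\<^sub>m 0"] exI[of _ "1\<^sub>m n"] exI[of _ "\<lambda>_. 0"] exI[of _ 0]) auto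
next
  case (Suc m)
  show ?case
  proof (cases "A = 0\<^sub>m (Suc m) n")
    case True
    have "dg (Suc m) n (\<lambda>_. 0) = (0\<^sub>m (Suc m) n :: dual_complex mat)" by (rule eq_matI) auto
    then have "A = 1\<^sub>m (Suc m) * dg (Suc m) n (\<lambda>_. 0) * (1\<^sub>m n)\<^sup>H"
      using True by (simp add: mat_simps)
    then show ?thesis
      using unitary_one
      by (intro exI[of _ "1\<^sub>m (Suc m)"] exI[of _ "1\<^sub>m n"] exI[of _ "\<lambda>_. 0"] exI[of _ 0]) auto
  next
    case False
    then have "n \<noteq> 0" using Suc.prems by (auto intro!: eq_matI)
    then obtain n' where n': "n = Suc n'" by (cases n) auto
    note A = Suc.prems[unfolded n']
    obtain x y \<sigma> where x: "x \<in> carrier_mat (Suc m) 1" "x\<^sup>H * x = 1\<^sub>m 1"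
      and y: "y \<in> carrier_mat (Suc n') 1" "y\<^sup>H * y = 1\<^sub>m 1"
      and \<sigma>: "if infinitesimal A then positive_infinitesimal \<sigma> else positive_appreciable \<sigma>"
        "A * y = \<sigma> \<cdot>\<^sub>m x" "A\<^sup>H * x = \<sigma> \<cdot>\<^sub>m y"
      using singular_pair[OF A] False n' by blast
    have cs: "conjugate \<sigma> = \<sigma>"
      using \<sigma>(1) by (auto simp: conjugate_self_iff positive_infinitesimal_def positive_appreciable_def split: if_splits)
    obtain U where U: "U \<in> carrier_mat (Suc m) (Suc m)" "unitary_dual U" "U * unit_col (Suc m) 0 = x"
      using unitary_extension[OF _ x] by blast
    obtain V where V: "V \<in> carrier_mat (Suc n') (Suc n')" "unitary_dual V" "V * unit_col (Suc n') 0 = y"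
      using unitary_extension[OF _ y] by blast
    obtain A' where A': "A' \<in> carrier_mat m n'" "U\<^sup>H * A * V = bdiag \<sigma> A'"
      using peel_block[OF A U(1,2) V(1,2), of \<sigma>] U(3) V(3) \<sigma> cs by auto
    obtain U' V' f r where IH: "U' \<in> carrier_mat m m" "unitary_dual U'" "V' \<in> carrier_mat n' n'" "unitary_dual V'"
      "A' = U' * dg m n' f * V'\<^sup>H" "r \<le> min m n'" "\<And>i. i < r \<Longrightarrow> positive_appreciable (f i)"
      "\<And>i. r \<le> i \<Longrightarrow> positive_infinitesimal (f i) \<or> f i = 0" "infinitesimal A' \<Longrightarrow> r = 0"
      using Suc.IH[OF A'(1)] by blast
    have inf: "r = 0" if "infinitesimal A"
    proof -
      have "infinitesimal (U\<^sup>H * A * V)"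
        using that A U(1) V(1) by (simp add: infinitesimal_mult)
      then have F: "std_part (bdiag \<sigma> A' $$ (i, j)) = 0" if "i < Suc m" "j < Suc n'" for i j
        unfolding A'(2) using that A'(1) by (auto simp: infinitesimal_def)
      have "std_part (A' $$ (i, j)) = 0" if "i < m" "j < n'" for i j
        using F[of "Suc i" "Suc j"] that A'(1) by simp
      then have "infinitesimal A'" using A'(1) by (auto simp: infinitesimal_def)
      then show ?thesis using IH by simp
    qed
    have bU: "bdiag 1 U' \<in> carrier_mat (Suc m) (Suc m)" "bdiag 1 V' \<in> carrier_mat (Suc n') (Suc n')"
      using IH(1,3) by (auto intro!: carrier_matI)
    \<comment> \<open>If \<open>A\<close> is infinitesimal, the new value is infinitesimal and heads
      the list, so the appreciable part must be empty; by \<open>inf\<close> the tail has none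
      either.\<close>
    define r' where "r' = (if infinitesimal A then 0 else Suc r)"
    have "U * bdiag 1 U' \<in> carrier_mat (Suc m) (Suc m)" "V * bdiag 1 V' \<in> carrier_mat (Suc n') (Suc n')"
      using mult_carrier_mat[OF U(1) bU(1)] mult_carrier_mat[OF V(1) bU(2)] .
    moreover have "unitary_dual (U * bdiag 1 U')" "unitary_dual (V * bdiag 1 V')"
      using unitary_mult[OF U(1) bU(1) U(2) unitary_bdiag[OF IH(1,2)]]
        unitary_mult[OF V(1) bU(2) V(2) unitary_bdiag[OF IH(3,4)]] .
    moreover have "A = (U * bdiag 1 U') * dg (Suc m) (Suc n') (case_nat \<sigma> f) * (V * bdiag 1 V')\<^sup>H"
      using peel_compose[OF A U(1,2) V(1,2) A'(2)[unfolded IH(5)] IH(1,3)] .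
    moreover have "r' \<le> min (Suc m) (Suc n')" using IH(6) by (auto simp: r'_def)
    moreover have "\<forall>i<r'. positive_appreciable (case_nat \<sigma> f i)"
      using \<sigma>(1) IH(7) by (auto simp: r'_def split: nat.splits if_splits)
    moreover have "\<forall>i. r' \<le> i \<longrightarrow> positive_infinitesimal (case_nat \<sigma> f i) \<or> case_nat \<sigma> f i = 0"
      using \<sigma>(1) IH(8) inf by (auto simp: r'_def split: nat.splits if_splits)
    moreover have "infinitesimal A \<longrightarrow> r' = 0" by (simp add: r'_def)
    ultimately show ?thesis unfolding n' by blast
  qed
qed

lemma dual_svd_exists: "\<exists>r U S1 S2 V. is_dual_svd A r U S1 S2 V"
proof -
  define m n where "m = dim_row A" "n = dim_col A"
  obtain U V f r where *: "U \<in> carrier_mat m m" "unitary_dual U" "V \<in> carrier_mat n n" "unitary_dual V"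
    "A = U * dg m n f * V\<^sup>H" "r \<le> min m n" "\<forall>i<r. positive_appreciable (f i)"
    "\<forall>i. r \<le> i \<longrightarrow> positive_infinitesimal (f i) \<or> f i = 0"
    using dual_svd_diagonal[of A m n] unfolding m_n_def by blast
  have "dg m n f = four_block_mat (dg r r f) (0\<^sub>m r (n - r)) (0\<^sub>m (m - r) r) (dg (m - r) (n - r) (\<lambda>i. f (i + r)))"
    using *(6) by (intro eq_matI) auto
  then have "is_dual_svd A r U (dg r r f) (dg (m - r) (n - r) (\<lambda>i. f (i + r))) V"
    using * unfolding is_dual_svd_def Let_def m_n_def[symmetric]
    by (auto simp: diagonal_mat_def)
  then show ?thesis by blast
qed

text \<open>Each SVD yields a decomposition of \<open>A\<close>, and its first component is unique.
  With existence of an SVD this resolves the definite description.\<close>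

lemma ess_decomp_essential_part:
  assumes "ess_decomp A C X"
  shows "essential_part A = C"
proof -
  let ?E = "\<lambda>r U S1 V. U * four_block_mat S1 (0\<^sub>m r (dim_col A - r)) (0\<^sub>m (dim_row A - r) r)
    (0\<^sub>m (dim_row A - r) (dim_col A - r)) * V\<^sup>H"
  have "?E r U S1 V = C" if svd: "is_dual_svd A r U S1 S2 V" for r U S1 S2 V
    using is_dual_svd_ess_decomp[OF svd] ess_decomp_unique(1)[OF _ assms] by blast
  then show ?thesis
    unfolding essential_part_def using dual_svd_exists[of A]
    by (intro the_equality) blast+
qed

lemma ess_decomp_exists: "ess_decomp A (essential_part A) (ndmpi A)"
proof -
  obtain C X where "ess_decomp A C X"
    using dual_svd_exists[of A] is_dual_svd_ess_decomp by blast
  then show ?thesis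
    using ess_decomp_essential_part ess_decomp_ndmpi by metis
qed

theorem theorem3p3:
  fixes A B :: "dual_complex mat" and m q n :: nat
  assumes "A \<in> carrier_mat m q" and "B \<in> carrier_mat q n"
    and "ndmpi A * A * B * conj_transpose B * conj_transpose A
           = B * conj_transpose B * conj_transpose (essential_part A)"
    and "B * ndmpi B * conj_transpose A * A * B
           = conj_transpose A * A * essential_part B"
  shows "ndmpi (A * B) = ndmpi B * ndmpi A"
proof -
  have "ess_decomp (A * B) (essential_part A * essential_part B) (ndmpi B * ndmpi A)"
    using ess_decomp_mult[OF assms(1) ess_decomp_exists assms(2) ess_decomp_exists assms(3,4)] .
  then show ?thesis
    using ess_decomp_ndmpi ess_decomp_essential_part by blast
qed

end
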